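(* For any 3-tensor $t$ over $\mathbb{F}$ not of the form $x\otimes y\otimes z$, and any integers $\alpha\geq0$, $\beta\geq1$, $$\frac{\omega(\langle2\rangle,t)\,\omega_{\mathrm{M}}\bigl(t,\langle2\rangle^{\otimes\alpha}\otimes\langle2,2,2\rangle^{\otimes\beta}\bigr)-\alpha}{\beta}\;\geq\;2\,\mathrm{irr}_{\mathrm{M}}(t)+\frac{\alpha}{\beta}\bigl(\mathrm{irr}_{\mathrm{M}}(t)-1\bigr)\;\geq\;2\,\mathrm{irr}_{\mathrm{M}}(t).$$
   Context: All tensors are 3-tensors over a fixed field $\mathbb{F}$, not of the form $x\otimes y\otimes z$. For $t \in \mathbb{F}^{n_1}\otimes\mathbb{F}^{n_2}\otimes\mathbb{F}^{n_3}$, $s\in \mathbb{F}^{m_1}\otimes\mathbb{F}^{m_2}\otimes\mathbb{F}^{m_3}$ write $t\geq s$ if there are linear maps $A_i:\mathbb{F}^{n_i}\to\mathbb{F}^{m_i}$ with $(A_1\otimes A_2\otimes A_3)t=s$, and $t\geq_{\mathrm{M}} s$ if such maps exist whose matrices in the standard bases are generalised sub-permutation matrices (at most one nonzero entry in each row and column). Tensor products and powers are regarded as 3-tensors by grouping factors. $\omega(t,s):=\lim_{n\to\infty}\frac1n\min\{m: t^{\otimes m}\geq s^{\otimes n}\}$ and $\omega_{\mathrm{M}}(t,s)$ is the same with $\geq_{\mathrm{M}}$ in place of $\geq$. $\langle n\rangle:=\sum_{i=1}^n e_i\otimes e_i\otimes e_i$. Monomial irreversibility: $\mathrm{irr}_{\mathrm{M}}(t):=\omega(\langle2\rangle,t)\,\omega_{\mathrm{M}}(t,\langle2\rangle)$.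 Matrix multiplication tensor: $\langle a,b,c\rangle:=\sum_{i=1}^a\sum_{j=1}^b\sum_{k=1}^c e_{(i,j)}\otimes e_{(j,k)}\otimes e_{(k,i)}$. *)

theory Defs
  imports "HOL-Library.Extended_Real" "Jordan_Normal_Form.Matrix"
begin

text \<open>
  An element of \<open>'a tensor3\<close> is a triple of dimensions together with an element of
  \<open>F^n1 \<otimes> F^n2 \<otimes> F^n3\<close>, given by its coordinates in the standard basis, indexed from 0.
  As for \<open>vec\<close> and \<open>mat\<close>, coordinates outside the index range are \<open>undefined\<close>, so that
  equality is equality of tensors.
\<close>

definition mk_tensor3 ::
  "nat \<Rightarrow> nat \<Rightarrow> nat \<Rightarrow> (nat \<Rightarrow> nat \<Rightarrow> nat \<Rightarrow> 'a) \<Rightarrow> (nat \<Rightarrow> nat \<Rightarrow> nat \<Rightarrow> 'a)" where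
  "mk_tensor3 n1 n2 n3 f =
     (\<lambda>i j k. if i < n1 \<and> j < n2 \<and> k < n3 then f i j k else undefined)"

typedef 'a tensor3 =
  "{(n1, n2, n3, mk_tensor3 n1 n2 n3 f) | n1 n2 n3 (f :: nat \<Rightarrow> nat \<Rightarrow> nat \<Rightarrow> 'a). True}"
  by blast

setup_lifting type_definition_tensor3

lift_definition tensor3 :: "nat \<Rightarrow> nat \<Rightarrow> nat \<Rightarrow> (nat \<Rightarrow> nat \<Rightarrow> nat \<Rightarrow> 'a) \<Rightarrow> 'a tensor3"
  is "\<lambda>n1 n2 n3 f. (n1, n2, n3, mk_tensor3 n1 n2 n3 f)" by auto

lift_definition dim1 :: "'a tensor3 \<Rightarrow> nat" is "\<lambda>(n1, n2, n3, f). n1" .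
lift_definition dim2 :: "'a tensor3 \<Rightarrow> nat" is "\<lambda>(n1, n2, n3, f). n2" .
lift_definition dim3 :: "'a tensor3 \<Rightarrow> nat" is "\<lambda>(n1, n2, n3, f). n3" .
lift_definition coord :: "'a tensor3 \<Rightarrow> nat \<Rightarrow> nat \<Rightarrow> nat \<Rightarrow> 'a" is "\<lambda>(n1, n2, n3, f). f" .

lemma dim_tensor3 [simp]:
  "dim1 (tensor3 n1 n2 n3 f) = n1"
  "dim2 (tensor3 n1 n2 n3 f) = n2"
  "dim3 (tensor3 n1 n2 n3 f) = n3"
  by (transfer; simp)+

lemma coord_tensor3 [simp]:
  "i < n1 \<Longrightarrow> j < n2 \<Longrightarrow> k < n3 \<Longrightarrow> coord (tensor3 n1 n2 n3 f) i j k = f i j k"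
  by transfer (simp add: mk_tensor3_def)

lemma tensor3_eqI:
  assumes "dim1 t = dim1 s" "dim2 t = dim2 s" "dim3 t = dim3 s"
    and "\<And>i j k. i < dim1 s \<Longrightarrow> j < dim2 s \<Longrightarrow> k < dim3 s \<Longrightarrow> coord t i j k = coord s i j k"
  shows "t = s"
  using assms by transfer (auto simp: mk_tensor3_def fun_eq_iff)

definition simple_tensor :: "'a::semiring_0 vec \<Rightarrow> 'a vec \<Rightarrow> 'a vec \<Rightarrow> 'a tensor3" where
  "simple_tensor x y z =
     tensor3 (dim_vec x) (dim_vec y) (dim_vec z) (\<lambda>i j k. x $ i * y $ j * z $ k)"

text \<open>The zero tensor is simple, since the factors may be zero.\<close>

definition is_simple :: "'a::semiring_0 tensor3 \<Rightarrow> bool" where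
  "is_simple t \<longleftrightarrow> (\<exists>x y z. t = simple_tensor x y z)"

text \<open>
  The tensor product regarded as a 3-tensor: in each of the three positions, the pair of
  indices \<open>(i, i')\<close> is encoded as \<open>i * m + i'\<close>, where \<open>m\<close> is the dimension of the second factor.
\<close>

definition kron :: "'a::semiring_0 tensor3 \<Rightarrow> 'a tensor3 \<Rightarrow> 'a tensor3" where
  "kron t s = tensor3 (dim1 t * dim1 s) (dim2 t * dim2 s) (dim3 t * dim3 s)
     (\<lambda>i j k. coord t (i div dim1 s) (j div dim2 s) (k div dim3 s)
            * coord s (i mod dim1 s) (j mod dim2 s) (k mod dim3 s))"

definition unit_tensor :: "nat \<Rightarrow> 'a::semiring_1 tensor3" where
  "unit_tensor n = tensor3 n n n (\<lambda>i j k. if i = j \<and> j = k then 1 else 0)"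

fun kron_pow :: "'a::semiring_1 tensor3 \<Rightarrow> nat \<Rightarrow> 'a tensor3" where
  "kron_pow t 0 = unit_tensor 1"
| "kron_pow t (Suc n) = kron t (kron_pow t n)"

text \<open>
  The basis vectors \<open>e_(i,j)\<close>, \<open>e_(j,k)\<close>, \<open>e_(k,i)\<close> are numbered by \<open>i * b + j\<close>,
  \<open>j * c + k\<close>, \<open>k * a + i\<close>, with all indices starting from 0.
\<close>

definition matmul_tensor :: "nat \<Rightarrow> nat \<Rightarrow> nat \<Rightarrow> 'a::semiring_1 tensor3" where
  "matmul_tensor a b c = tensor3 (a * b) (b * c) (c * a)
     (\<lambda>p q r. \<Sum>i<a. \<Sum>j<b. \<Sum>k<c.
        if p = i * b + j \<and> q = j * c + k \<and> r = k * a + i then 1 else 0)"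

definition map_tensor3 ::
  "'a::comm_semiring_1 mat \<Rightarrow> 'a mat \<Rightarrow> 'a mat \<Rightarrow> 'a tensor3 \<Rightarrow> 'a tensor3" where
  "map_tensor3 A1 A2 A3 t = tensor3 (dim_row A1) (dim_row A2) (dim_row A3)
     (\<lambda>i j k. \<Sum>i'<dim1 t. \<Sum>j'<dim2 t. \<Sum>k'<dim3 t.
        A1 $$ (i, i') * A2 $$ (j, j') * A3 $$ (k, k') * coord t i' j' k')"

definition restricts :: "'a::field tensor3 \<Rightarrow> 'a tensor3 \<Rightarrow> bool" where
  "restricts t s \<longleftrightarrow>
     (\<exists>A1 \<in> carrier_mat (dim1 s) (dim1 t).
      \<exists>A2 \<in> carrier_mat (dim2 s) (dim2 t).
      \<exists>A3 \<in> carrier_mat (dim3 s) (dim3 t).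
        map_tensor3 A1 A2 A3 t = s)"

definition gen_sub_permutation :: "'a::zero mat \<Rightarrow> bool" where
  "gen_sub_permutation A \<longleftrightarrow>
     (\<forall>i < dim_row A. card {j. j < dim_col A \<and> A $$ (i, j) \<noteq> 0} \<le> 1) \<and>
     (\<forall>j < dim_col A. card {i. i < dim_row A \<and> A $$ (i, j) \<noteq> 0} \<le> 1)"

definition monomially_restricts :: "'a::field tensor3 \<Rightarrow> 'a tensor3 \<Rightarrow> bool" where
  "monomially_restricts t s \<longleftrightarrow>
     (\<exists>A1 \<in> carrier_mat (dim1 s) (dim1 t).
      \<exists>A2 \<in> carrier_mat (dim2 s) (dim2 t).
      \<exists>A3 \<in> carrier_mat (dim3 s) (dim3 t).
        gen_sub_permutation A1 \<and> gen_sub_permutation A2 \<and> gen_sub_permutation A3 \<and>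
        map_tensor3 A1 A2 A3 t = s)"

text \<open>
  The minimum is over a set of natural numbers that may be empty (no monomial restriction
  exists, say, from a power of a tensor without zero coordinates to \<open>\<langle>2\<rangle>\<close>). It is then
  \<open>\<infinity>\<close>; this is why the exponents take values in \<open>ereal\<close>.
\<close>

definition relative_exponent ::
  "('a::field tensor3 \<Rightarrow> 'a tensor3 \<Rightarrow> bool) \<Rightarrow> 'a tensor3 \<Rightarrow> 'a tensor3 \<Rightarrow> ereal" where
  "relative_exponent R t s =
     lim (\<lambda>n. ereal (1 / real n) * (INF m \<in> {m. R (kron_pow t m) (kron_pow s n)}. ereal (real m)))"

definition omega :: "'a::field tensor3 \<Rightarrow> 'a tensor3 \<Rightarrow> ereal" where
  "omega = relative_exponent restricts"

definition omega_M :: "'a::field tensor3 \<Rightarrow> 'a tensor3 \<Rightarrow> ereal" where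
  "omega_M = relative_exponent monomially_restricts"

definition irr_M :: "'a::field tensor3 \<Rightarrow> ereal" where
  "irr_M t = omega (unit_tensor 2) t * omega_M t (unit_tensor 2)"

end

theory Submission
  imports Defs "Jordan_Normal_Form.Determinant" "HOL-Library.FuncSet"
begin

text \<open>
  The target \<open>q = \<langle>2\<rangle>^\<alpha> \<otimes> \<langle>2,2,2\<rangle>^\<beta>\<close> satisfies \<open>\<omega>_M(t, q) \<ge> (\<alpha> + 2\<beta>) \<omega>_M(t, \<langle>2\<rangle>)\<close>, because
  \<open>\<langle>2,2,2\<rangle>^n\<close> restricts monomially to \<open>\<langle>2\<rangle>^(2n - o(n))\<close>: a Behrend-type set of triples selects
  a diagonal of size \<open>2^(2p^2 - 7p)\<close> in \<open>\<langle>2,2,2\<rangle>^(p^2)\<close>. Multiplying by \<open>\<omega>(\<langle>2\<rangle>, t)\<close> gives the first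
  inequality. The second one is \<open>irr_M(t) \<ge> 1\<close>: a chain \<open>\<langle>2\<rangle>^k \<ge> t^m \<ge> \<langle>2\<rangle>^n\<close> forces \<open>k \<ge> n\<close> by
  flattening rank. As \<open>\<omega>_M\<close> may be infinite, one also needs \<open>1 \<le> \<omega>(\<langle>2\<rangle>, t) < \<infinity>\<close>; the lower bound
  holds because some flattening of a non-simple tensor has rank at least 2, hence at least \<open>2^n\<close>
  for its \<open>n\<close>-th power.
\<close>

section \<open>Restrictions\<close>

text \<open>A monomial restriction can only rescale, delete and relabel basis vectors. No
  cancellation is available, so the diagonal in a power of \<langle>2,2,2\<rangle> must already sit
  there as a subtensor and has to be found combinatorially. Its exponent 2 per factor counts the
  free coordinates of a triple (x, y, z) with prescribed sum. The construction loses a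
  subexponential factor, so a relation between \<open>t^m\<close> and \<open>q^n\<close> is first
  raised to a large power, chosen so that the number of factors \<langle>2,2,2\<rangle> is a perfect
  square; the loss then vanishes in the limit. Replacing the limits in the exponents by infima over
  feasible pairs allows this to be done for one pair at a time.\<close>

definition idx :: "'a tensor3 \<Rightarrow> (nat \<times> nat \<times> nat) set" where
  "idx t = {..<dim1 t} \<times> {..<dim2 t} \<times> {..<dim3 t}"

lemma finite_idx [simp]: "finite (idx t)"
  by (simp add: idx_def)

definition contract ::
  "(nat \<Rightarrow> nat \<Rightarrow> 'a::comm_semiring_1) \<Rightarrow> (nat \<Rightarrow> nat \<Rightarrow> 'a) \<Rightarrow> (nat \<Rightarrow> nat \<Rightarrow> 'a) \<Rightarrow> 'a tensor3
    \<Rightarrow> nat \<Rightarrow> nat \<Rightarrow> nat \<Rightarrow> 'a" where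
  "contract A1 A2 A3 t i j k =
     (\<Sum>(i', j', k') \<in> idx t. A1 i i' * A2 j j' * A3 k k' * coord t i' j' k')"

text \<open>One relation serves both orders: \<open>Q\<close> constantly true gives restriction,
  \<open>Q = monomial\<close> its monomial variant. \<open>Q\<close> takes the dimensions as
  arguments because coefficient functions, unlike matrices, do not carry them.\<close>

definition restr_by ::
  "(nat \<Rightarrow> nat \<Rightarrow> (nat \<Rightarrow> nat \<Rightarrow> 'a::field) \<Rightarrow> bool) \<Rightarrow> 'a tensor3 \<Rightarrow> 'a tensor3 \<Rightarrow> bool" where
  "restr_by Q t s \<longleftrightarrow> (\<exists>A1 A2 A3.
     Q (dim1 s) (dim1 t) A1 \<and> Q (dim2 s) (dim2 t) A2 \<and> Q (dim3 s) (dim3 t) A3 \<and>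
     (\<forall>i < dim1 s. \<forall>j < dim2 s. \<forall>k < dim3 s. coord s i j k = contract A1 A2 A3 t i j k))"

definition monomial :: "nat \<Rightarrow> nat \<Rightarrow> (nat \<Rightarrow> nat \<Rightarrow> 'a::zero) \<Rightarrow> bool" where
  "monomial n m A \<longleftrightarrow>
     (\<forall>i<n. \<forall>j<m. \<forall>j'<m. A i j \<noteq> 0 \<longrightarrow> A i j' \<noteq> 0 \<longrightarrow> j = j') \<and>
     (\<forall>j<m. \<forall>i<n. \<forall>i'<n. A i j \<noteq> 0 \<longrightarrow> A i' j \<noteq> 0 \<longrightarrow> i = i')"

lemma map_tensor3_eq_iff:
  assumes "A1 \<in> carrier_mat (dim1 s) (dim1 t)" "A2 \<in> carrier_mat (dim2 s) (dim2 t)"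
    "A3 \<in> carrier_mat (dim3 s) (dim3 t)"
  shows "map_tensor3 A1 A2 A3 t = s \<longleftrightarrow>
    (\<forall>i < dim1 s. \<forall>j < dim2 s. \<forall>k < dim3 s. coord s i j k =
       contract (\<lambda>i j. A1 $$ (i, j)) (\<lambda>i j. A2 $$ (i, j)) (\<lambda>i j. A3 $$ (i, j)) t i j k)"
    (is "?l \<longleftrightarrow> ?r")
proof -
  have *: "coord (map_tensor3 A1 A2 A3 t) i j k =
      contract (\<lambda>i j. A1 $$ (i, j)) (\<lambda>i j. A2 $$ (i, j)) (\<lambda>i j. A3 $$ (i, j)) t i j k"
    if "i < dim1 s" "j < dim2 s" "k < dim3 s" for i j k
    using that assms by (simp add: map_tensor3_def contract_def idx_def sum.cartesian_product)
  show ?thesis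
  proof
    assume ?l
    then show ?r using * by metis
  next
    assume ?r
    then show ?l
      using assms * by (intro tensor3_eqI) (auto simp: map_tensor3_def)
  qed
qed

lemma contract_cong:
  assumes "\<And>i'. i' < dim1 t \<Longrightarrow> A1 i i' = B1 i i'" "\<And>i'. i' < dim2 t \<Longrightarrow> A2 j i' = B2 j i'"
    "\<And>i'. i' < dim3 t \<Longrightarrow> A3 k i' = B3 k i'"
  shows "contract A1 A2 A3 t i j k = contract B1 B2 B3 t i j k"
  unfolding contract_def by (rule sum.cong) (auto simp: idx_def assms)

lemma restricts_iff: "restricts t s \<longleftrightarrow> restr_by (\<lambda>_ _ _. True) t s"
proof
  assume "restricts t s"
  then obtain A1 A2 A3 where "A1 \<in> carrier_mat (dim1 s) (dim1 t)"
    "A2 \<in> carrier_mat (dim2 s) (dim2 t)" "A3 \<in> carrier_mat (dim3 s) (dim3 t)"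
    "map_tensor3 A1 A2 A3 t = s"
    unfolding restricts_def by blast
  then show "restr_by (\<lambda>_ _ _. True) t s"
    unfolding restr_by_def
    by (intro exI[of _ "\<lambda>i j. A1 $$ (i, j)"] exI[of _ "\<lambda>i j. A2 $$ (i, j)"]
        exI[of _ "\<lambda>i j. A3 $$ (i, j)"]) (simp add: map_tensor3_eq_iff)
next
  assume "restr_by (\<lambda>_ _ _. True) t s"
  then obtain A1 A2 A3 where A: "\<And>i j k. \<lbrakk>i < dim1 s; j < dim2 s; k < dim3 s\<rbrakk> \<Longrightarrow>
      coord s i j k = contract A1 A2 A3 t i j k"
    unfolding restr_by_def by blast
  let ?M = "\<lambda>n m f. mat n m (\<lambda>(i, j). f i j)"
  show "restricts t s"
    unfolding restricts_def
    by (intro bexI[of _ "?M _ _ A1"] bexI[of _ "?M _ _ A2"] bexI[of _ "?M _ _ A3"],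
        subst map_tensor3_eq_iff) (auto simp: A intro!: contract_cong)
qed

lemma gen_sub_permutation_iff:
  assumes "A \<in> carrier_mat n m"
  shows "gen_sub_permutation A \<longleftrightarrow> monomial n m (\<lambda>i j. A $$ (i, j))"
  using assms unfolding gen_sub_permutation_def monomial_def One_nat_def
  by (auto simp: card_le_Suc0_iff_eq)

lemma monomially_restricts_iff: "monomially_restricts t s \<longleftrightarrow> restr_by monomial t s"
proof
  assume "monomially_restricts t s"
  then obtain A1 A2 A3 where "A1 \<in> carrier_mat (dim1 s) (dim1 t)"
    "A2 \<in> carrier_mat (dim2 s) (dim2 t)" "A3 \<in> carrier_mat (dim3 s) (dim3 t)"
    "gen_sub_permutation A1" "gen_sub_permutation A2" "gen_sub_permutation A3"
    "map_tensor3 A1 A2 A3 t = s"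
    unfolding monomially_restricts_def by blast
  then show "restr_by monomial t s"
    unfolding restr_by_def
    by (intro exI[of _ "\<lambda>i j. A1 $$ (i, j)"] exI[of _ "\<lambda>i j. A2 $$ (i, j)"]
        exI[of _ "\<lambda>i j. A3 $$ (i, j)"]) (simp add: map_tensor3_eq_iff gen_sub_permutation_iff)
next
  assume "restr_by monomial t s"
  then obtain A1 A2 A3 where A: "\<And>i j k. \<lbrakk>i < dim1 s; j < dim2 s; k < dim3 s\<rbrakk> \<Longrightarrow>
      coord s i j k = contract A1 A2 A3 t i j k"
    and P: "monomial (dim1 s) (dim1 t) A1" "monomial (dim2 s) (dim2 t) A2"
      "monomial (dim3 s) (dim3 t) A3"
    unfolding restr_by_def by blast
  let ?M = "\<lambda>n m f. mat n m (\<lambda>(i, j). f i j)"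
  have M: "gen_sub_permutation (?M n m f)" if "monomial n m f" for n m f
    using that by (subst gen_sub_permutation_iff[of _ n m]) (auto simp: monomial_def)
  have "map_tensor3 (?M (dim1 s) (dim1 t) A1) (?M (dim2 s) (dim2 t) A2) (?M (dim3 s) (dim3 t) A3) t = s"
    by (subst map_tensor3_eq_iff) (auto simp: A intro!: contract_cong)
  moreover have "?M n m f \<in> carrier_mat n m" for n m f
    by simp
  ultimately show "monomially_restricts t s"
    unfolding monomially_restricts_def using M P by meson
qed

section \<open>Tensor products\<close>

lemma dim_kron [simp]:
  "dim1 (kron t s) = dim1 t * dim1 s"
  "dim2 (kron t s) = dim2 t * dim2 s"
  "dim3 (kron t s) = dim3 t * dim3 s"
  by (simp_all add: kron_def)

lemma dim_unit_tensor [simp]: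
  "dim1 (unit_tensor n) = n" "dim2 (unit_tensor n) = n" "dim3 (unit_tensor n) = n"
  by (simp_all add: unit_tensor_def)

lemma coord_unit_tensor:
  "\<lbrakk>i < n; j < n; k < n\<rbrakk> \<Longrightarrow> coord (unit_tensor n) i j k = (if i = j \<and> j = k then 1 else 0)"
  by (simp add: unit_tensor_def)

lemma coord_kron:
  "\<lbrakk>i < dim1 t * dim1 s; j < dim2 t * dim2 s; k < dim3 t * dim3 s\<rbrakk> \<Longrightarrow>
    coord (kron t s) i j k = coord t (i div dim1 s) (j div dim2 s) (k div dim3 s)
      * coord s (i mod dim1 s) (j mod dim2 s) (k mod dim3 s)"
  by (simp add: kron_def)

lemma pair_less: "x * b + y < a * b" if "x < a" "y < b" for x y a b :: nat
proof -
  have "x * b + y < Suc x * b" using that by simp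
  also have "\<dots> \<le> a * b" using that by (intro mult_le_mono1) auto
  finally show ?thesis .
qed

lemma mod_less_of_mult: "i mod b < b" if "i < a * b" for i a b :: nat
  using that by (cases "b = 0") auto

lemma coord_kron_pair:
  assumes "x < dim1 t" "x' < dim1 s" "y < dim2 t" "y' < dim2 s" "z < dim3 t" "z' < dim3 s"
  shows "coord (kron t s) (x * dim1 s + x') (y * dim2 s + y') (z * dim3 s + z')
    = coord t x y z * coord s x' y' z'"
  using assms by (subst coord_kron) (auto simp: pair_less)

lemma sum_idx_kron:
  "(\<Sum>(i, j, k) \<in> idx (kron t s). f (i div dim1 s) (i mod dim1 s) (j div dim2 s) (j mod dim2 s)
        (k div dim3 s) (k mod dim3 s))
   = (\<Sum>(i, j, k) \<in> idx t. \<Sum>(i', j', k') \<in> idx s. f i i' j j' k k')"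
proof -
  have "(\<Sum>(i, j, k) \<in> idx t. \<Sum>(i', j', k') \<in> idx s. f i i' j j' k k')
      = (\<Sum>((i, j, k), (i', j', k')) \<in> idx t \<times> idx s. f i i' j j' k k')"
    by (simp add: sum.cartesian_product case_prod_unfold)
  also have "\<dots> = (\<Sum>(i, j, k) \<in> idx (kron t s). f (i div dim1 s) (i mod dim1 s)
      (j div dim2 s) (j mod dim2 s) (k div dim3 s) (k mod dim3 s))"
    by (rule sum.reindex_bij_witness[of _
        "\<lambda>(i, j, k). ((i div dim1 s, j div dim2 s, k div dim3 s),
           (i mod dim1 s, j mod dim2 s, k mod dim3 s))"
        "\<lambda>((i, j, k), (i', j', k')). (i * dim1 s + i', j * dim2 s + j', k * dim3 s + k')"])
      (auto simp: idx_def pair_less less_mult_imp_div_less mod_less_of_mult)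
  finally show ?thesis by simp
qed

text \<open>Mixed-radix codes of index triples agree for both bracketings, so this is an equality
  and not just an isomorphism. Powers can therefore be split and regrouped without reindexing
  maps.\<close>

lemma kron_assoc: "kron (kron t s) u = kron t (kron s u)"
proof (rule tensor3_eqI; (simp add: mult.assoc)?)
  fix i j k
  assume b: "i < dim1 t * (dim1 s * dim1 u)" "j < dim2 t * (dim2 s * dim2 u)"
    "k < dim3 t * (dim3 s * dim3 u)"
  have 1: "x div c < a * b" if "x < a * (b * c)" for x a b c :: nat
    using that by (simp add: less_mult_imp_div_less mult.assoc)
  have 2: "x div c div b = x div (b * c)" for x b c :: nat
    by (metis div_mult2_eq mult.commute)
  have 3: "x div c mod b = x mod (b * c) div c" for x b c :: nat
    by (cases "c = 0") (simp_all add: mult.commute[of b c] mod_mult2_eq)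
  have 4: "x mod c = x mod (b * c) mod c" for x b c :: nat
    by (simp add: mod_mod_cancel)
  show "coord (kron (kron t s) u) i j k = coord (kron t (kron s u)) i j k"
    using b 1[OF b(1)] 1[OF b(2)] 1[OF b(3)] mod_less_of_mult[OF b(1)] mod_less_of_mult[OF b(2)]
      mod_less_of_mult[OF b(3)]
    by (simp add: coord_kron mult.assoc 2 3 flip: 4)
qed

lemma kron_unit_left [simp]: "kron (unit_tensor 1) t = t"
  by (rule tensor3_eqI) (auto simp: coord_kron coord_unit_tensor)

lemma kron_unit_right [simp]: "kron t (unit_tensor 1) = t"
  by (rule tensor3_eqI) (auto simp: coord_kron coord_unit_tensor)

lemma kron_unit_unit: "kron (unit_tensor a) (unit_tensor b) = unit_tensor (a * b)"
proof (rule tensor3_eqI; simp)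
  fix i j k assume b: "i < a * b" "j < a * b" "k < a * b"
  have e: "x div b = y div b \<and> x mod b = y mod b \<longleftrightarrow> x = y" for x y :: nat
    by (metis div_mult_mod_eq)
  show "coord (kron (unit_tensor a) (unit_tensor b)) i j k = coord (unit_tensor (a * b)) i j k"
    using b e[of i j] e[of j k]
    by (auto simp: coord_kron coord_unit_tensor less_mult_imp_div_less mod_less_of_mult)
qed

lemma kron_pow_unit: "kron_pow (unit_tensor a) n = unit_tensor (a ^ n)"
  by (induction n) (simp_all add: kron_unit_unit)

lemma kron_pow_add: "kron_pow t (m + n) = kron (kron_pow t m) (kron_pow t n)"
  by (induction m) (simp_all add: kron_assoc kron_unit_left[unfolded One_nat_def])

lemma kron_pow_mult: "kron_pow t (m * n) = kron_pow (kron_pow t m) n"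
  by (induction n) (simp_all add: kron_pow_add)

section \<open>Classes of restrictions\<close>

lemma prod3_sum:
  fixes f :: "'x \<Rightarrow> 'a::comm_semiring_1"
  shows "sum f X * sum g Y * sum h Z = (\<Sum>(i, j, k) \<in> X \<times> Y \<times> Z. f i * g j * h k)"
proof -
  have "(\<Sum>(i, j, k) \<in> X \<times> Y \<times> Z. f i * g j * h k) = (\<Sum>i\<in>X. \<Sum>j\<in>Y. f i * g j * sum h Z)"
    by (simp only: sum.cartesian_product[symmetric] sum_distrib_left)
  also have "\<dots> = (\<Sum>i\<in>X. \<Sum>j\<in>Y. f i * g j) * sum h Z"
    by (simp only: sum_distrib_right)
  finally show ?thesis by (simp only: sum_product)
qed

lemma contract_contract:
  assumes "\<And>i j k. \<lbrakk>i < dim1 s; j < dim2 s; k < dim3 s\<rbrakk> \<Longrightarrow>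
    coord s i j k = contract A1 A2 A3 t i j k"
  shows "contract B1 B2 B3 s i j k = contract (\<lambda>i k. \<Sum>j<dim1 s. B1 i j * A1 j k)
     (\<lambda>i k. \<Sum>j<dim2 s. B2 i j * A2 j k) (\<lambda>i k. \<Sum>j<dim3 s. B3 i j * A3 j k) t i j k"
proof -
  have "contract B1 B2 B3 s i j k = (\<Sum>p \<in> idx s. \<Sum>q \<in> idx t. case p of (i', j', k') \<Rightarrow>
      case q of (l1, l2, l3) \<Rightarrow> (B1 i i' * A1 i' l1) * (B2 j j' * A2 j' l2) * (B3 k k' * A3 k' l3)
        * coord t l1 l2 l3)"
    unfolding contract_def[of B1]
  proof (rule sum.cong[OF refl], clarify)
    fix i' j' k' assume "(i', j', k') \<in> idx s"
    then have "coord s i' j' k' = contract A1 A2 A3 t i' j' k'"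
      by (intro assms) (auto simp: idx_def)
    then show "B1 i i' * B2 j j' * B3 k k' * coord s i' j' k' = (\<Sum>(l1, l2, l3) \<in> idx t.
        (B1 i i' * A1 i' l1) * (B2 j j' * A2 j' l2) * (B3 k k' * A3 k' l3) * coord t l1 l2 l3)"
      by (simp add: contract_def sum_distrib_left case_prod_unfold mult_ac)
  qed
  also have "\<dots> = (\<Sum>q \<in> idx t. \<Sum>p \<in> idx s. case p of (i', j', k') \<Rightarrow>
      case q of (l1, l2, l3) \<Rightarrow> (B1 i i' * A1 i' l1) * (B2 j j' * A2 j' l2) * (B3 k k' * A3 k' l3)
        * coord t l1 l2 l3)"
    by (rule sum.swap)
  also have "\<dots> = contract (\<lambda>i k. \<Sum>j<dim1 s. B1 i j * A1 j k)
     (\<lambda>i k. \<Sum>j<dim2 s. B2 i j * A2 j k) (\<lambda>i k. \<Sum>j<dim3 s. B3 i j * A3 j k) t i j k"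
    unfolding contract_def prod3_sum
    by (intro sum.cong refl) (auto simp: idx_def sum_distrib_right case_prod_unfold)
  finally show ?thesis .
qed

lemma contract_kron:
  "contract (\<lambda>i j. A1 (i div n1) (j div dim1 t') * B1 (i mod n1) (j mod dim1 t'))
     (\<lambda>i j. A2 (i div n2) (j div dim2 t') * B2 (i mod n2) (j mod dim2 t'))
     (\<lambda>i j. A3 (i div n3) (j div dim3 t') * B3 (i mod n3) (j mod dim3 t')) (kron t t') i j k
   = contract A1 A2 A3 t (i div n1) (j div n2) (k div n3)
     * contract B1 B2 B3 t' (i mod n1) (j mod n2) (k mod n3)"
  (is "?l = ?r")
proof -
  let ?a = "\<lambda>x y z. A1 (i div n1) x * A2 (j div n2) y * A3 (k div n3) z * coord t x y z"
  let ?b = "\<lambda>x y z. B1 (i mod n1) x * B2 (j mod n2) y * B3 (k mod n3) z * coord t' x y z"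
  have "?l = (\<Sum>(x, y, z) \<in> idx (kron t t').
      ?a (x div dim1 t') (y div dim2 t') (z div dim3 t')
      * ?b (x mod dim1 t') (y mod dim2 t') (z mod dim3 t'))"
    unfolding contract_def by (intro sum.cong refl) (auto simp: idx_def coord_kron mult_ac)
  also have "\<dots> = (\<Sum>(x, y, z) \<in> idx t. \<Sum>(x', y', z') \<in> idx t'. ?a x y z * ?b x' y' z')"
    by (rule sum_idx_kron[where f = "\<lambda>x x' y y' z z'. ?a x y z * ?b x' y' z'"])
  also have "\<dots> = ?r"
    by (simp add: contract_def sum_product case_prod_unfold)
  finally show ?thesis .
qed

lemma contract_select:
  assumes "e1 i < dim1 t" "e2 j < dim2 t" "e3 k < dim3 t"
  shows "contract (\<lambda>i i'. if i' = e1 i then c i else 0) (\<lambda>j j'. if j' = e2 j then 1 else 0)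
     (\<lambda>k k'. if k' = e3 k then 1 else 0) t i j k = c i * coord t (e1 i) (e2 j) (e3 k)"
proof -
  have "contract (\<lambda>i i'. if i' = e1 i then c i else 0) (\<lambda>j j'. if j' = e2 j then 1 else 0)
     (\<lambda>k k'. if k' = e3 k then 1 else 0) t i j k
    = (\<Sum>p \<in> idx t. if p = (e1 i, e2 j, e3 k) then c i * coord t (e1 i) (e2 j) (e3 k) else 0)"
    unfolding contract_def by (intro sum.cong refl) (auto split: if_splits)
  also have "\<dots> = c i * coord t (e1 i) (e2 j) (e3 k)"
    using assms by (simp add: idx_def)
  finally show ?thesis .
qed

lemma monomial_select:
  "inj_on e {..<n} \<Longrightarrow> monomial n m (\<lambda>i i'. if i' = e i then c i else 0)"
  by (auto simp: monomial_def inj_on_def)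

text \<open>Matrices whose rows have one nonzero entry each, in distinct columns, cut out a
  subtensor. Weights on the first position alone are enough to normalise a single nonzero coordinate
  to 1.\<close>

lemma restr_by_select:
  assumes "inj_on ea {..<dim1 s}" "inj_on eb {..<dim2 s}" "inj_on ec {..<dim3 s}"
    and "ea ` {..<dim1 s} \<subseteq> {..<dim1 t}" "eb ` {..<dim2 s} \<subseteq> {..<dim2 t}"
      "ec ` {..<dim3 s} \<subseteq> {..<dim3 t}"
    and "\<And>i j k. \<lbrakk>i < dim1 s; j < dim2 s; k < dim3 s\<rbrakk> \<Longrightarrow>
      coord s i j k = c i * coord t (ea i) (eb j) (ec k)"
  shows "restr_by monomial t s"
  unfolding restr_by_def
  by (rule exI[of _ "\<lambda>i i'. if i' = ea i then c i else 0"],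
      rule exI[of _ "\<lambda>j j'. if j' = eb j then 1 else 0"],
      rule exI[of _ "\<lambda>k k'. if k' = ec k then 1 else 0"])
    (use assms in \<open>auto intro!: monomial_select simp: contract_select image_subset_iff\<close>)

text \<open>\<open>comp\<close> yields transitivity and \<open>kron\<close> compatibility with
  tensor products; \<open>monomial\<close> supplies the selections behind reflexivity and
  \<open>restr_by_unit_one\<close>.\<close>

locale restriction_class =
  fixes Q :: "nat \<Rightarrow> nat \<Rightarrow> (nat \<Rightarrow> nat \<Rightarrow> 'a::field) \<Rightarrow> bool"
  assumes comp: "Q n m A \<Longrightarrow> Q m l B \<Longrightarrow> Q n l (\<lambda>i k. \<Sum>j<m. A i j * B j k)"
    and kron: "Q n m A \<Longrightarrow> Q n' m' B \<Longrightarrow>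
      Q (n * n') (m * m') (\<lambda>i j. A (i div n') (j div m') * B (i mod n') (j mod m'))"
    and monomial: "monomial n m A \<Longrightarrow> Q n m A"
begin

lemma restr_by_of_monomial: "restr_by monomial t s \<Longrightarrow> restr_by Q t s"
  unfolding restr_by_def using monomial by blast

lemma restr_by_refl: "restr_by Q t t"
  by (intro restr_by_of_monomial restr_by_select[where ea = id and eb = id and ec = id
        and c = "\<lambda>_. 1"]) auto

lemma restr_by_trans:
  assumes "restr_by Q t s" "restr_by Q s u"
  shows "restr_by Q t u"
proof -
  obtain A1 A2 A3 where A: "Q (dim1 s) (dim1 t) A1" "Q (dim2 s) (dim2 t) A2"
      "Q (dim3 s) (dim3 t) A3"
    and cA: "\<And>i j k. \<lbrakk>i < dim1 s; j < dim2 s; k < dim3 s\<rbrakk> \<Longrightarrow>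
      coord s i j k = contract A1 A2 A3 t i j k"
    using assms(1) unfolding restr_by_def by blast
  obtain B1 B2 B3 where B: "Q (dim1 u) (dim1 s) B1" "Q (dim2 u) (dim2 s) B2"
      "Q (dim3 u) (dim3 s) B3"
    and cB: "\<And>i j k. \<lbrakk>i < dim1 u; j < dim2 u; k < dim3 u\<rbrakk> \<Longrightarrow>
      coord u i j k = contract B1 B2 B3 s i j k"
    using assms(2) unfolding restr_by_def by blast
  show ?thesis
    unfolding restr_by_def
  proof (intro exI conjI allI impI)
    show "Q (dim1 u) (dim1 t) (\<lambda>i k. \<Sum>j<dim1 s. B1 i j * A1 j k)"
      "Q (dim2 u) (dim2 t) (\<lambda>i k. \<Sum>j<dim2 s. B2 i j * A2 j k)"
      "Q (dim3 u) (dim3 t) (\<lambda>i k. \<Sum>j<dim3 s. B3 i j * A3 j k)"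
      using comp A B by blast+
  next
    fix i j k assume "i < dim1 u" "j < dim2 u" "k < dim3 u"
    then show "coord u i j k = contract (\<lambda>i k. \<Sum>j<dim1 s. B1 i j * A1 j k)
        (\<lambda>i k. \<Sum>j<dim2 s. B2 i j * A2 j k) (\<lambda>i k. \<Sum>j<dim3 s. B3 i j * A3 j k) t i j k"
      using cA by (simp add: cB contract_contract)
  qed
qed

lemma restr_by_kron:
  assumes "restr_by Q t s" "restr_by Q t' s'"
  shows "restr_by Q (kron t t') (kron s s')"
proof -
  obtain A1 A2 A3 where A: "Q (dim1 s) (dim1 t) A1" "Q (dim2 s) (dim2 t) A2"
      "Q (dim3 s) (dim3 t) A3"
    and cA: "\<And>i j k. \<lbrakk>i < dim1 s; j < dim2 s; k < dim3 s\<rbrakk> \<Longrightarrow>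
      coord s i j k = contract A1 A2 A3 t i j k"
    using assms(1) unfolding restr_by_def by blast
  obtain B1 B2 B3 where B: "Q (dim1 s') (dim1 t') B1" "Q (dim2 s') (dim2 t') B2"
      "Q (dim3 s') (dim3 t') B3"
    and cB: "\<And>i j k. \<lbrakk>i < dim1 s'; j < dim2 s'; k < dim3 s'\<rbrakk> \<Longrightarrow>
      coord s' i j k = contract B1 B2 B3 t' i j k"
    using assms(2) unfolding restr_by_def by blast
  show ?thesis
    unfolding restr_by_def dim_kron
  proof (intro exI conjI allI impI)
    fix i j k
    assume "i < dim1 s * dim1 s'" "j < dim2 s * dim2 s'" "k < dim3 s * dim3 s'"
    then show "coord (kron s s') i j k = contract
        (\<lambda>i j. A1 (i div dim1 s') (j div dim1 t') * B1 (i mod dim1 s') (j mod dim1 t'))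
        (\<lambda>i j. A2 (i div dim2 s') (j div dim2 t') * B2 (i mod dim2 s') (j mod dim2 t'))
        (\<lambda>i j. A3 (i div dim3 s') (j div dim3 t') * B3 (i mod dim3 s') (j mod dim3 t'))
        (kron t t') i j k"
      by (simp add: contract_kron coord_kron cA cB less_mult_imp_div_less mod_less_of_mult)
  qed (use kron A B in blast)+
qed

lemma restr_by_kron_pow: "restr_by Q t s \<Longrightarrow> restr_by Q (kron_pow t n) (kron_pow s n)"
  by (induction n) (auto intro: restr_by_refl restr_by_kron)

lemma restr_by_unit_one:
  assumes "i < dim1 t" "j < dim2 t" "k < dim3 t" "coord t i j k \<noteq> 0"
  shows "restr_by Q t (unit_tensor 1)"
  by (rule restr_by_of_monomial, rule restr_by_select[where ea = "\<lambda>_. i" and eb = "\<lambda>_. j"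
        and ec = "\<lambda>_. k" and c = "\<lambda>_. 1 / coord t i j k"])
    (use assms in \<open>auto simp: coord_unit_tensor inj_on_def\<close>)

lemma kron_pow_unit_one: "kron_pow (unit_tensor 1) n = unit_tensor 1"
  by (simp add: kron_pow_unit del: One_nat_def)

end

section \<open>The two instances: arbitrary and monomial matrices\<close>

lemma monomialD1: "\<lbrakk>monomial n m A; A i j \<noteq> 0; A i j' \<noteq> 0; i < n; j < m; j' < m\<rbrakk> \<Longrightarrow> j = j'"
  unfolding monomial_def by blast

lemma monomialD2: "\<lbrakk>monomial n m A; A i j \<noteq> 0; A i' j \<noteq> 0; i < n; i' < n; j < m\<rbrakk> \<Longrightarrow> i = i'"
  unfolding monomial_def by blast

lemma monomial_comp:
  fixes A B :: "nat \<Rightarrow> nat \<Rightarrow> 'a::semiring_0"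
  assumes "monomial n m A" "monomial m l B"
  shows "monomial n l (\<lambda>i k. \<Sum>j<m. A i j * B j k)"
proof -
  have *: "\<exists>j<m. A i j \<noteq> 0 \<and> B j k \<noteq> 0" if "(\<Sum>j<m. A i j * B j k) \<noteq> 0" for i k
    using sum.not_neutral_contains_not_neutral[OF that] by (metis lessThan_iff mult_not_zero)
  show ?thesis
    unfolding monomial_def
  proof (intro conjI allI impI)
    fix i k k' assume "i < n" "k < l" "k' < l" "(\<Sum>j<m. A i j * B j k) \<noteq> 0"
      "(\<Sum>j<m. A i j * B j k') \<noteq> 0"
    then obtain j j' where "j < m" "A i j \<noteq> 0" "B j k \<noteq> 0" "j' < m" "A i j' \<noteq> 0" "B j' k' \<noteq> 0"
      using *[of i k] *[of i k'] by blast
    moreover from this have "j = j'"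
      using monomialD1[OF assms(1)] \<open>i < n\<close> by blast
    ultimately show "k = k'"
      using monomialD1[OF assms(2)] \<open>k < l\<close> \<open>k' < l\<close> by blast
  next
    fix k i i' assume "k < l" "i < n" "i' < n" "(\<Sum>j<m. A i j * B j k) \<noteq> 0"
      "(\<Sum>j<m. A i' j * B j k) \<noteq> 0"
    then obtain j j' where "j < m" "A i j \<noteq> 0" "B j k \<noteq> 0" "j' < m" "A i' j' \<noteq> 0" "B j' k \<noteq> 0"
      using *[of i k] *[of i' k] by blast
    moreover from this have "j = j'"
      using monomialD2[OF assms(2)] \<open>k < l\<close> by blast
    ultimately show "i = i'"
      using monomialD2[OF assms(1)] \<open>i < n\<close> \<open>i' < n\<close> by blast
  qed
qed

lemma monomial_kron:
  fixes A B :: "nat \<Rightarrow> nat \<Rightarrow> 'a::semiring_0"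
  assumes "monomial n m A" "monomial n' m' B"
  shows "monomial (n * n') (m * m') (\<lambda>i j. A (i div n') (j div m') * B (i mod n') (j mod m'))"
  unfolding monomial_def
proof (intro conjI allI impI)
  fix i j j' assume b: "i < n * n'" "j < m * m'" "j' < m * m'"
    and "A (i div n') (j div m') * B (i mod n') (j mod m') \<noteq> 0"
      "A (i div n') (j' div m') * B (i mod n') (j' mod m') \<noteq> 0"
  then have nz: "A (i div n') (j div m') \<noteq> 0" "B (i mod n') (j mod m') \<noteq> 0"
    "A (i div n') (j' div m') \<noteq> 0" "B (i mod n') (j' mod m') \<noteq> 0"
    by (metis mult_not_zero)+
  have "j div m' = j' div m'" "j mod m' = j' mod m'"
    using monomialD1[OF assms(1) nz(1,3)] monomialD1[OF assms(2) nz(2,4)]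
    by (simp_all add: b[THEN less_mult_imp_div_less] b[THEN mod_less_of_mult])
  then show "j = j'" by (metis div_mult_mod_eq)
next
  fix j i i' assume b: "j < m * m'" "i < n * n'" "i' < n * n'"
    and "A (i div n') (j div m') * B (i mod n') (j mod m') \<noteq> 0"
      "A (i' div n') (j div m') * B (i' mod n') (j mod m') \<noteq> 0"
  then have nz: "A (i div n') (j div m') \<noteq> 0" "B (i mod n') (j mod m') \<noteq> 0"
    "A (i' div n') (j div m') \<noteq> 0" "B (i' mod n') (j mod m') \<noteq> 0"
    by (metis mult_not_zero)+
  have "i div n' = i' div n'" "i mod n' = i' mod n'"
    using monomialD2[OF assms(1) nz(1,3)] monomialD2[OF assms(2) nz(2,4)]
    by (simp_all add: b[THEN less_mult_imp_div_less] b[THEN mod_less_of_mult])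
  then show "i = i'" by (metis div_mult_mod_eq)
qed

global_interpretation linear: restriction_class "\<lambda>_ _ _. True"
  by unfold_locales auto

global_interpretation monom: restriction_class monomial
  by unfold_locales (auto intro: monomial_comp monomial_kron)

section \<open>Exponents as infima\<close>

text \<open>
  Fekete's lemma for \<open>n \<mapsto> min {m. S m n}\<close>, which is subadditive; downward closure makes it
  monotone, so that it is finite everywhere as soon as it is finite at some \<open>n \<ge> 1\<close>.
\<close>

lemma exponent_tendsto:
  fixes S :: "nat \<Rightarrow> nat \<Rightarrow> bool"
  assumes S0: "S 0 0" and add: "\<And>m n m' n'. S m n \<Longrightarrow> S m' n' \<Longrightarrow> S (m + m') (n + n')"
    and down: "\<And>m n n'. S m n \<Longrightarrow> n' \<le> n \<Longrightarrow> S m n'"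
  shows "(\<lambda>n. ereal (1 / real n) * (INF m \<in> {m. S m n}. ereal (real m)))
    \<longlonglongrightarrow> (INF (m, n) \<in> {(m, n). 1 \<le> n \<and> S m n}. ereal (real m / real n))"
    (is "?F \<longlonglongrightarrow> ?L")
proof -
  have mult: "S (l * m) (l * n)" if "S m n" for l m n
    by (induction l) (auto intro: S0 add that)
  show ?thesis
  proof (rule order_tendstoI)
    fix a assume a: "a < ?L"
    have "?L \<le> ?F n" if n: "n \<ge> 1" for n
    proof -
      \<comment> \<open>The infimum may be \<infinity>, so the bound is shown in multiplied form
        first and only then scaled by \<open>1 / n\<close>.\<close>
      have "ereal (real n) * ?L \<le> (INF m \<in> {m. S m n}. ereal (real m))"
      proof (rule INF_greatest)
        fix m assume "m \<in> {m. S m n}"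
        then have "?L \<le> ereal (real m / real n)"
          using n by (intro INF_lower2[of "(m, n)"]) auto
        then have "ereal (real n) * ?L \<le> ereal (real n) * ereal (real m / real n)"
          by (intro ereal_mult_left_mono) auto
        then show "ereal (real n) * ?L \<le> ereal (real m)"
          using n by simp
      qed
      then have "ereal (1 / real n) * (ereal (real n) * ?L) \<le> ?F n"
        by (intro ereal_mult_left_mono) auto
      moreover have "ereal (1 / real n) * (ereal (real n) * ?L) = ?L"
        using n by (simp add: mult.assoc[symmetric] one_ereal_def[symmetric])
      ultimately show ?thesis by simp
    qed
    then show "\<forall>\<^sub>F n in sequentially. a < ?F n"
      using a by (auto simp: eventually_sequentially intro!: exI[of _ 1] intro: less_le_trans)
  next
    fix a assume "?L < a"
    then obtain m k where k: "k \<ge> 1" "S m k" and lt: "ereal (real m / real k) < a"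
      by (auto simp: INF_less_iff)
    have le: "?F n \<le> ereal (real m / real k + real m / real n)" if n: "n \<ge> 1" for n
    proof -
      \<comment> \<open>Rounding \<open>n\<close> up to a multiple of \<open>k\<close> costs at most
        one surplus block of \<open>m\<close> factors: the error \<open>m / n\<close>.\<close>
      have "n \<le> (n div k + 1) * k"
        using k dividend_less_div_times[of k n] by (simp add: add.commute)
      then have "S ((n div k + 1) * m) n"
        using mult[OF k(2)] down by blast
      then have "(INF m \<in> {m. S m n}. ereal (real m)) \<le> ereal (real ((n div k + 1) * m))"
        by (intro INF_lower) simp
      then have "?F n \<le> ereal (1 / real n) * ereal (real ((n div k + 1) * m))"
        by (intro ereal_mult_left_mono) auto
      also have "\<dots> = ereal (real (n div k) * real m / real n + real m / real n)"
        by (simp add: field_simps add_divide_distrib)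
      also have "\<dots> \<le> ereal (real m / real k + real m / real n)"
      proof -
        have "real (n div k) \<le> real n / real k" by (rule of_nat_div_le_of_nat)
        then have "real (n div k) * real m / real n \<le> real n / real k * real m / real n"
          by (intro divide_right_mono mult_right_mono) auto
        then show ?thesis using n by simp
      qed
      finally show ?thesis .
    qed
    have "(\<lambda>n. ereal (real m / real k + real m / real n)) \<longlonglongrightarrow> ereal (real m / real k + 0)"
      by (intro tendsto_intros lim_const_over_n)
    then have "\<forall>\<^sub>F n in sequentially. ereal (real m / real k + real m / real n) < a"
      using lt by (intro order_tendstoD(2)) auto
    moreover have "\<forall>\<^sub>F n in sequentially. n \<ge> (1::nat)"
      by (rule eventually_ge_at_top)
    ultimately show "\<forall>\<^sub>F n in sequentially. ?F n < a"
      by eventually_elim (use le in \<open>blast intro: le_less_trans\<close>)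
  qed
qed

definition nonzero :: "'a::zero tensor3 \<Rightarrow> bool" where
  "nonzero t \<longleftrightarrow> (\<exists>i j k. i < dim1 t \<and> j < dim2 t \<and> k < dim3 t \<and> coord t i j k \<noteq> 0)"

definition feasible ::
  "('a::field tensor3 \<Rightarrow> 'a tensor3 \<Rightarrow> bool) \<Rightarrow> 'a tensor3 \<Rightarrow> 'a tensor3 \<Rightarrow> (nat \<times> nat) set" where
  "feasible R t s = {(m, n). 1 \<le> n \<and> R (kron_pow t m) (kron_pow s n)}"

context restriction_class
begin

lemma restr_by_kron_pow_mult:
  "restr_by Q (kron_pow t m) (kron_pow s n) \<Longrightarrow> restr_by Q (kron_pow t (l * m)) (kron_pow s (l * n))"
  using restr_by_kron_pow[of "kron_pow t m" "kron_pow s n" l]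
  by (simp add: kron_pow_mult[symmetric] mult.commute)

text \<open>A nonzero coordinate of \<open>s\<close>, rescaled to 1, gives a restriction from
  \<open>s\<close> to \<langle>1\<rangle>, so surplus factors can be discarded. This is the downward
  closure demanded by \<open>exponent_tendsto\<close>.\<close>

lemma restr_by_kron_pow_le:
  assumes "nonzero s" "n' \<le> n"
  shows "restr_by Q (kron_pow s n) (kron_pow s n')"
proof -
  have "restr_by Q (kron_pow s (n - n')) (unit_tensor 1)"
    using assms restr_by_unit_one restr_by_kron_pow[of s "unit_tensor 1"]
    by (metis nonzero_def kron_pow_unit_one)
  then have "restr_by Q (kron (kron_pow s (n - n')) (kron_pow s n'))
      (kron (unit_tensor 1) (kron_pow s n'))"
    by (intro restr_by_kron restr_by_refl)
  then show ?thesis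
    using assms(2) by (simp only: kron_pow_add[symmetric] kron_unit_left le_add_diff_inverse2)
qed

lemma relative_exponent_eq_INF:
  assumes "nonzero s"
  shows "relative_exponent (restr_by Q) t s
    = (INF (m, n) \<in> feasible (restr_by Q) t s. ereal (real m / real n))"
  unfolding relative_exponent_def feasible_def
proof (rule limI, rule exponent_tendsto)
  show "restr_by Q (kron_pow t 0) (kron_pow s 0)"
    by (simp add: restr_by_refl)
next
  fix m n m' n'
  assume "restr_by Q (kron_pow t m) (kron_pow s n)" "restr_by Q (kron_pow t m') (kron_pow s n')"
  then show "restr_by Q (kron_pow t (m + m')) (kron_pow s (n + n'))"
    by (simp add: kron_pow_add restr_by_kron)
next
  fix m n n' assume "restr_by Q (kron_pow t m) (kron_pow s n)" "n' \<le> n"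
  then show "restr_by Q (kron_pow t m) (kron_pow s n')"
    using restr_by_kron_pow_le[OF assms] restr_by_trans by blast
qed

end

lemma restricts_eq: "restricts = restr_by (\<lambda>_ _ _. True)"
  by (simp add: fun_eq_iff restricts_iff)

lemma monomially_restricts_eq: "monomially_restricts = restr_by monomial"
  by (simp add: fun_eq_iff monomially_restricts_iff)

lemma omega_eq_INF:
  "nonzero s \<Longrightarrow> omega t s = (INF (m, n) \<in> feasible restricts t s. ereal (real m / real n))"
  by (simp add: omega_def restricts_eq linear.relative_exponent_eq_INF)

lemma omega_M_eq_INF:
  "nonzero s \<Longrightarrow>
    omega_M t s = (INF (m, n) \<in> feasible monomially_restricts t s. ereal (real m / real n))"
  by (simp add: omega_M_def monomially_restricts_eq monom.relative_exponent_eq_INF)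

section \<open>Flattening rank\<close>

text \<open>
  With \<open>M\<close> the flattening of \<open>t\<close> whose rows are indexed by the first position, \<open>rank M \<ge> r\<close> is
  expressed as \<open>P M Q = 1\<close> for some \<open>P\<close>, \<open>Q\<close>; in this form it is visibly multiplicative.
\<close>

definition flat_rank_ge :: "'a::comm_semiring_1 tensor3 \<Rightarrow> nat \<Rightarrow> bool" where
  "flat_rank_ge t r \<longleftrightarrow> (\<exists>P Q. \<forall>a<r. \<forall>b<r.
     (\<Sum>(i, j, k) \<in> idx t. P a i * Q b j k * coord t i j k) = (if a = b then 1 else 0))"

text \<open>If \<open>r\<close> exceeded \<open>dim1 t\<close>, padding the two factors of the
  identity with zeros would make them square. A one-sided inverse of a square matrix is two-sided,
  but the product in the other order has a zero row.\<close>

lemma flat_rank_ge_le_dim1: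
  fixes t :: "'a::field tensor3"
  assumes "flat_rank_ge t r"
  shows "r \<le> dim1 t"
proof (rule ccontr)
  let ?d = "dim1 t"
  assume "\<not> r \<le> ?d"
  then have d: "?d < r" by simp
  obtain P Q where PQ: "\<And>a b. a < r \<Longrightarrow> b < r \<Longrightarrow>
      (\<Sum>(i, j, k) \<in> idx t. P a i * Q b j k * coord t i j k) = (if a = b then 1 else 0)"
    using assms unfolding flat_rank_ge_def by blast
  define M where "M i b = (\<Sum>(j, k) \<in> {..<dim2 t} \<times> {..<dim3 t}. Q b j k * coord t i j k)" for i b
  define A where "A = mat r r (\<lambda>(a, i). if i < ?d then P a i else 0)"
  define B where "B = mat r r (\<lambda>(i, b). if i < ?d then M i b else 0)"
  have AB: "A * B = 1\<^sub>m r"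
  proof (rule eq_matI)
    fix a b assume "a < dim_row (1\<^sub>m r :: 'a mat)" "b < dim_col (1\<^sub>m r :: 'a mat)"
    then have ab: "a < r" "b < r" by simp_all
    have "(A * B) $$ (a, b) = (\<Sum>i<r. if i < ?d then P a i * M i b else 0)"
      using ab by (auto simp: A_def B_def scalar_prod_def lessThan_atLeast0 intro!: sum.cong)
    also have "\<dots> = (\<Sum>i<?d. P a i * M i b)"
      using d by (intro sum.mono_neutral_cong_right) auto
    also have "\<dots> = (\<Sum>(i, j, k) \<in> idx t. P a i * Q b j k * coord t i j k)"
      unfolding M_def idx_def sum_distrib_left
      by (subst sum.cartesian_product) (auto simp: mult_ac intro!: sum.cong)
    finally show "(A * B) $$ (a, b) = 1\<^sub>m r $$ (a, b)"
      using ab PQ by simp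
  qed (simp_all add: A_def B_def)
  have "B * A = 1\<^sub>m r"
    by (rule mat_mult_left_right_inverse[OF _ _ AB]) (simp_all add: A_def B_def)
  then have "(B * A) $$ (?d, ?d) = 1" using d by simp
  moreover have "(B * A) $$ (?d, ?d) = 0"
    using d by (simp add: A_def B_def scalar_prod_def)
  ultimately show False by simp
qed

text \<open>The restriction maps are absorbed into the witnesses: \<open>A1\<close> into
  \<open>P\<close>, and the tensor product of \<open>A2\<close> and \<open>A3\<close> into
  \<open>R\<close>.\<close>

lemma flat_rank_ge_restr:
  assumes "restr_by Q t s" "flat_rank_ge s r"
  shows "flat_rank_ge t r"
proof -
  obtain A1 A2 A3 where A: "\<And>i j k. \<lbrakk>i < dim1 s; j < dim2 s; k < dim3 s\<rbrakk> \<Longrightarrow>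
      coord s i j k = contract A1 A2 A3 t i j k"
    using assms(1) unfolding restr_by_def by blast
  obtain P R where PR: "\<And>a b. a < r \<Longrightarrow> b < r \<Longrightarrow>
      (\<Sum>(i, j, k) \<in> idx s. P a i * R b j k * coord s i j k) = (if a = b then 1 else 0)"
    using assms(2) unfolding flat_rank_ge_def by blast
  let ?P = "\<lambda>a x. \<Sum>i<dim1 s. P a i * A1 i x"
  let ?R = "\<lambda>b y z. \<Sum>(j, k) \<in> {..<dim2 s} \<times> {..<dim3 s}. R b j k * A2 j y * A3 k z"
  show ?thesis
    unfolding flat_rank_ge_def
  proof (intro exI[of _ ?P] exI[of _ ?R] allI impI)
    fix a b assume ab: "a < r" "b < r"
    have "(\<Sum>(x, y, z) \<in> idx t. ?P a x * ?R b y z * coord t x y z) =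
        (\<Sum>q \<in> idx t. \<Sum>p \<in> idx s. case p of (i, j, k) \<Rightarrow> case q of (x, y, z) \<Rightarrow>
           P a i * A1 i x * (R b j k * A2 j y * A3 k z) * coord t x y z)"
    proof (rule sum.cong[OF refl], clarify)
      fix x y z
      have "?P a x * ?R b y z = (\<Sum>(i, j, k) \<in> idx s.
          P a i * A1 i x * (R b j k * A2 j y * A3 k z))"
        by (simp add: sum_product sum.cartesian_product idx_def case_prod_unfold)
      then show "?P a x * ?R b y z * coord t x y z = (\<Sum>(i, j, k) \<in> idx s.
          P a i * A1 i x * (R b j k * A2 j y * A3 k z) * coord t x y z)"
        by (simp add: sum_distrib_right case_prod_unfold)
    qed
    also have "\<dots> = (\<Sum>p \<in> idx s. \<Sum>q \<in> idx t. case p of (i, j, k) \<Rightarrow> case q of (x, y, z) \<Rightarrow>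
           P a i * A1 i x * (R b j k * A2 j y * A3 k z) * coord t x y z)"
      by (rule sum.swap)
    also have "\<dots> = (\<Sum>(i, j, k) \<in> idx s. P a i * R b j k * coord s i j k)"
    proof (rule sum.cong[OF refl], clarify)
      fix i j k assume "(i, j, k) \<in> idx s"
      then have "coord s i j k = contract A1 A2 A3 t i j k"
        by (intro A) (auto simp: idx_def)
      then show "(\<Sum>(x, y, z) \<in> idx t. P a i * A1 i x * (R b j k * A2 j y * A3 k z) * coord t x y z)
          = P a i * R b j k * coord s i j k"
        by (simp add: contract_def sum_distrib_left case_prod_unfold mult_ac)
    qed
    finally show "(\<Sum>(x, y, z) \<in> idx t. ?P a x * ?R b y z * coord t x y z)
        = (if a = b then 1 else 0)"
      using PR[OF ab] by simp
  qed
qed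

lemma flat_rank_ge_unit: "flat_rank_ge (unit_tensor r :: 'a::comm_semiring_1 tensor3) r"
  unfolding flat_rank_ge_def
proof (intro exI allI impI)
  fix a b assume ab: "a < r" "b < r"
  have "(\<Sum>(i, j, k) \<in> idx (unit_tensor r :: 'a tensor3).
      (if a = i then 1 else 0) * (if b = j then 1 else 0) * coord (unit_tensor r) i j k)
    = (\<Sum>p \<in> idx (unit_tensor r :: 'a tensor3). if p = (a, a, a) then if a = b then 1 else 0 else 0)"
    by (intro sum.cong refl) (auto simp: idx_def coord_unit_tensor split: if_splits)
  also have "\<dots> = (if a = b then 1 else 0)"
    using ab by (simp add: idx_def)
  finally show "(\<Sum>(i, j, k) \<in> idx (unit_tensor r :: 'a tensor3).
      (if a = i then 1 else 0) * (if b = j then 1 else 0) * coord (unit_tensor r) i j k)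
    = (if a = b then 1 else 0)" .
qed

text \<open>The flattening of a tensor product is the Kronecker product of the flattenings, so
  Kronecker products of the witnesses work.\<close>

lemma flat_rank_ge_kron:
  assumes "flat_rank_ge t r" "flat_rank_ge s l"
  shows "flat_rank_ge (kron t s) (r * l)"
proof -
  obtain P R where PR: "\<And>a b. a < r \<Longrightarrow> b < r \<Longrightarrow>
      (\<Sum>(i, j, k) \<in> idx t. P a i * R b j k * coord t i j k) = (if a = b then 1 else 0)"
    using assms(1) unfolding flat_rank_ge_def by blast
  obtain P' R' where PR': "\<And>a b. a < l \<Longrightarrow> b < l \<Longrightarrow>
      (\<Sum>(i, j, k) \<in> idx s. P' a i * R' b j k * coord s i j k) = (if a = b then 1 else 0)"
    using assms(2) unfolding flat_rank_ge_def by blast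
  let ?P = "\<lambda>a i. P (a div l) (i div dim1 s) * P' (a mod l) (i mod dim1 s)"
  let ?R = "\<lambda>b j k. R (b div l) (j div dim2 s) (k div dim3 s) * R' (b mod l) (j mod dim2 s) (k mod dim3 s)"
  show ?thesis
    unfolding flat_rank_ge_def
  proof (intro exI[of _ ?P] exI[of _ ?R] allI impI)
    fix a b assume ab: "a < r * l" "b < r * l"
    let ?f = "\<lambda>i j k. P (a div l) i * R (b div l) j k * coord t i j k"
    let ?g = "\<lambda>i j k. P' (a mod l) i * R' (b mod l) j k * coord s i j k"
    have "(\<Sum>(i, j, k) \<in> idx (kron t s). ?P a i * ?R b j k * coord (kron t s) i j k)
      = (\<Sum>(i, j, k) \<in> idx (kron t s). ?f (i div dim1 s) (j div dim2 s) (k div dim3 s)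
          * ?g (i mod dim1 s) (j mod dim2 s) (k mod dim3 s))"
      by (intro sum.cong refl) (auto simp: idx_def coord_kron mult_ac)
    also have "\<dots> = (\<Sum>(i, j, k) \<in> idx t. \<Sum>(i', j', k') \<in> idx s. ?f i j k * ?g i' j' k')"
      by (rule sum_idx_kron[where f = "\<lambda>i i' j j' k k'. ?f i j k * ?g i' j' k'"])
    also have "\<dots> = (\<Sum>(i, j, k) \<in> idx t. ?f i j k) * (\<Sum>(i, j, k) \<in> idx s. ?g i j k)"
      by (simp add: sum_product case_prod_unfold)
    also have "\<dots> = (if a div l = b div l \<and> a mod l = b mod l then 1 else 0)"
      using ab[THEN less_mult_imp_div_less] ab[THEN mod_less_of_mult]
      by (simp add: PR PR')
    also have "a div l = b div l \<and> a mod l = b mod l \<longleftrightarrow> a = b"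
      by (metis div_mult_mod_eq)
    finally show "(\<Sum>(i, j, k) \<in> idx (kron t s). ?P a i * ?R b j k * coord (kron t s) i j k)
      = (if a = b then 1 else 0)" .
  qed
qed

lemma flat_rank_ge_kron_pow: "flat_rank_ge t r \<Longrightarrow> flat_rank_ge (kron_pow t n) (r ^ n)"
  using flat_rank_ge_unit[of 1] by (induction n) (auto intro: flat_rank_ge_kron)

section \<open>Flattening rank at least 2 for non-simple tensors\<close>

lemma flat_rank_ge_minor:
  fixes t :: "'a::field tensor3"
  assumes b: "x0 < dim1 t" "x1 < dim1 t" "y0 < dim2 t" "y1 < dim2 t" "z0 < dim3 t" "z1 < dim3 t"
    and nz: "coord t x0 y0 z0 * coord t x1 y1 z1 \<noteq> coord t x0 y1 z1 * coord t x1 y0 z0"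
  shows "flat_rank_ge t 2"
proof -
  define p q u v where "p = coord t x0 y0 z0" and "q = coord t x0 y1 z1"
    and "u = coord t x1 y0 z0" and "v = coord t x1 y1 z1"
  define D where "D = p * v - q * u"
  have D: "D \<noteq> 0" using nz by (simp add: D_def p_def q_def u_def v_def)
  define x where "x a = (if a = 0 then x0 else x1)" for a :: nat
  \<comment> \<open>The two rows of the inverse of the minor with rows (p, q) and (u, v), by
    Cramer's rule; \<open>x\<close> selects the rows of the flattening.\<close>
  define \<alpha> \<beta> where "\<alpha> b = (if b = 0 then v / D else - q / D)"
    and "\<beta> b = (if b = 0 then - u / D else p / D)" for b :: nat
  have x: "x a < dim1 t" for a using b by (simp add: x_def)
  \<comment> \<open>A sum of two conditionals instead of a nested one, so that the columns need not
    be known to be distinct.\<close>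
  have "(\<Sum>(i, j, k) \<in> idx t. (if i = x a then 1 else 0) *
      ((if (j, k) = (y0, z0) then \<alpha> b else 0) + (if (j, k) = (y1, z1) then \<beta> b else 0))
      * coord t i j k)
    = \<alpha> b * coord t (x a) y0 z0 + \<beta> b * coord t (x a) y1 z1" for a b
  proof -
    have "(\<Sum>(i, j, k) \<in> idx t. (if i = x a then 1 else 0) *
        ((if (j, k) = (y0, z0) then \<alpha> b else 0) + (if (j, k) = (y1, z1) then \<beta> b else 0))
        * coord t i j k)
      = (\<Sum>w \<in> idx t. (if w = (x a, y0, z0) then \<alpha> b * coord t (x a) y0 z0 else 0)
          + (if w = (x a, y1, z1) then \<beta> b * coord t (x a) y1 z1 else 0))"
      by (intro sum.cong refl) (auto simp: distrib_right split: if_splits)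
    then show ?thesis
      using x b by (simp add: sum.distrib idx_def)
  qed
  moreover have "\<alpha> b * coord t (x a) y0 z0 + \<beta> b * coord t (x a) y1 z1 = (if a = b then 1 else 0)"
    if "a < 2" "b < 2" for a b
  proof -
    have "a = 0 \<or> a = 1" "b = 0 \<or> b = 1" using that by auto
    moreover have "v / D * p + - u / D * q = 1" "- q / D * u + p / D * v = 1"
      "v / D * u + - u / D * v = 0" "- q / D * p + p / D * q = 0"
      using D by (simp_all add: field_simps) (simp_all add: D_def algebra_simps)
    ultimately show ?thesis
      by (auto simp: \<alpha>_def \<beta>_def x_def p_def q_def u_def v_def)
  qed
  ultimately show ?thesis
    unfolding flat_rank_ge_def
    by (intro exI[of _ "\<lambda>a i. if i = x a then 1 else 0"] exI[of _ "\<lambda>b j k.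
      (if (j, k) = (y0, z0) then \<alpha> b else 0) + (if (j, k) = (y1, z1) then \<beta> b else 0)"]) simp
qed

text \<open>Turns the second flattening into the first, so that the facts on
  \<open>flat_rank_ge\<close> cover both.\<close>

definition swap12 :: "'a tensor3 \<Rightarrow> 'a tensor3" where
  "swap12 t = tensor3 (dim2 t) (dim1 t) (dim3 t) (\<lambda>i j k. coord t j i k)"

lemma dim_swap12 [simp]:
  "dim1 (swap12 t) = dim2 t" "dim2 (swap12 t) = dim1 t" "dim3 (swap12 t) = dim3 t"
  by (simp_all add: swap12_def)

lemma coord_swap12:
  "\<lbrakk>i < dim2 t; j < dim1 t; k < dim3 t\<rbrakk> \<Longrightarrow> coord (swap12 t) i j k = coord t j i k"
  by (simp add: swap12_def)

lemma swap12_unit: "swap12 (unit_tensor n) = unit_tensor n"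
  by (rule tensor3_eqI) (auto simp: coord_swap12 coord_unit_tensor)

lemma swap12_kron: "swap12 (kron t s) = kron (swap12 t) (swap12 s)"
  by (rule tensor3_eqI)
    (auto simp: coord_swap12 coord_kron less_mult_imp_div_less mod_less_of_mult)

lemma swap12_kron_pow: "swap12 (kron_pow t n) = kron_pow (swap12 t) n"
  by (induction n) (auto simp: swap12_unit swap12_kron)

lemma restricts_swap12:
  assumes "restricts t s"
  shows "restricts (swap12 t) (swap12 s)"
proof -
  obtain A1 A2 A3 where A: "\<And>i j k. \<lbrakk>i < dim1 s; j < dim2 s; k < dim3 s\<rbrakk> \<Longrightarrow>
      coord s i j k = contract A1 A2 A3 t i j k"
    using assms unfolding restricts_iff restr_by_def by blast
  have "contract A2 A1 A3 (swap12 t) i j k = contract A1 A2 A3 t j i k" for i j k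
    unfolding contract_def
    by (rule sum.reindex_bij_witness[of _ "\<lambda>(x, y, z). (y, x, z)" "\<lambda>(x, y, z). (y, x, z)"])
      (auto simp: idx_def coord_swap12 mult_ac)
  then show ?thesis
    unfolding restricts_iff restr_by_def
    by (intro exI[of _ A2] exI[of _ A1] exI[of _ A3]) (auto simp: coord_swap12 A)
qed

lemma not_simple_nonzero:
  assumes "\<not> is_simple t"
  shows "nonzero t"
proof (rule ccontr)
  assume "\<not> nonzero t"
  then have "t = simple_tensor (0\<^sub>v (dim1 t)) (0\<^sub>v (dim2 t)) (0\<^sub>v (dim3 t))"
    by (intro tensor3_eqI) (auto simp: simple_tensor_def nonzero_def)
  then show False using assms unfolding is_simple_def by blast
qed

text \<open>
  If all \<open>2 \<times> 2\<close> minors of the first two flattenings through a nonzero entry vanish, then \<open>t\<close> is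
  a product.
\<close>

lemma not_simple_flat_rank:
  fixes t :: "'a::field tensor3"
  assumes "\<not> is_simple t"
  shows "flat_rank_ge t 2 \<or> flat_rank_ge (swap12 t) 2"
proof (rule ccontr)
  assume neg: "\<not> ?thesis"
  obtain i0 j0 k0 where b: "i0 < dim1 t" "j0 < dim2 t" "k0 < dim3 t"
    and nz: "coord t i0 j0 k0 \<noteq> 0"
    using not_simple_nonzero[OF assms] unfolding nonzero_def by blast
  let ?v = "coord t i0 j0 k0"
  have 1: "?v * coord t i j k = coord t i0 j k * coord t i j0 k0"
    if "i < dim1 t" "j < dim2 t" "k < dim3 t" for i j k
    using flat_rank_ge_minor[of i0 t i j0 j k0 k] neg b that by blast
  \<comment> \<open>Rows \<open>j0\<close>, \<open>j\<close> and columns \<open>(i0, k0)\<close>,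
    \<open>(i0, k)\<close> of the second flattening: the slice at \<open>i0\<close> has rank
    one.\<close>
  have 2: "?v * coord t i0 j k = coord t i0 j0 k * coord t i0 j k0"
    if "j < dim2 t" "k < dim3 t" for j k
    using flat_rank_ge_minor[of j0 "swap12 t" j i0 i0 k0 k] neg b that
    by (auto simp: coord_swap12)
  \<comment> \<open>Fact 1 splits off the first index and fact 2 separates the other two. Each costs
    one factor \<open>?v\<close>, hence the denominator \<open>?v * ?v\<close>.\<close>
  have "t = simple_tensor (vec (dim1 t) (\<lambda>i. coord t i j0 k0 / (?v * ?v)))
      (vec (dim2 t) (\<lambda>j. coord t i0 j k0)) (vec (dim3 t) (\<lambda>k. coord t i0 j0 k))"
  proof (rule tensor3_eqI; simp add: simple_tensor_def)
    fix i j k assume ijk: "i < dim1 t" "j < dim2 t" "k < dim3 t"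
    have "?v * ?v * coord t i j k = (?v * coord t i0 j k) * coord t i j0 k0"
      using 1[OF ijk] by (simp add: mult_ac)
    also have "\<dots> = coord t i0 j0 k * coord t i0 j k0 * coord t i j0 k0"
      using 2[OF ijk(2,3)] by simp
    finally show "coord t i j k = coord t i j0 k0 * coord t i0 j k0 * coord t i0 j0 k / (?v * ?v)"
      using nz by (simp add: field_simps)
  qed
  then show False using assms unfolding is_simple_def by blast
qed

section \<open>Irreversibility\<close>

lemma restricts_unit_unit: "restricts (unit_tensor n :: 'a::field tensor3) (unit_tensor m) \<Longrightarrow> m \<le> n"
  using flat_rank_ge_restr[OF _ flat_rank_ge_unit] flat_rank_ge_le_dim1
  unfolding restricts_iff by fastforce

text \<open>Whichever of the two flattenings has rank at least 2, its powers are bounded by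
  \<open>N\<close>, because unit tensors are fixed by \<open>swap12\<close>.\<close>

lemma not_simple_restricts_pow:
  assumes "\<not> is_simple t" "restricts (unit_tensor N) (kron_pow t n)"
  shows "2 ^ n \<le> N"
  using not_simple_flat_rank[OF assms(1)]
proof
  assume "flat_rank_ge t 2"
  then show ?thesis
    using flat_rank_ge_le_dim1[OF flat_rank_ge_restr[OF assms(2)[unfolded restricts_iff]
        flat_rank_ge_kron_pow]] by simp
next
  assume "flat_rank_ge (swap12 t) 2"
  moreover have "restricts (unit_tensor N) (kron_pow (swap12 t) n)"
    using restricts_swap12[OF assms(2)] by (simp add: swap12_unit swap12_kron_pow)
  ultimately show ?thesis
    using flat_rank_ge_le_dim1[OF flat_rank_ge_restr[OF _ flat_rank_ge_kron_pow]]
    unfolding restricts_iff by fastforce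
qed

lemma unit_restricts:
  fixes t :: "'a::field tensor3"
  assumes "dim1 t * dim2 t * dim3 t \<le> r"
  shows "restricts (unit_tensor r) t"
proof -
  \<comment> \<open>Each coordinate of \<open>t\<close> gets its own diagonal term \<open>l\<close>,
    the code of its index triple, with the value placed in \<open>?A3\<close>. A surplus
    \<open>l\<close> decodes to a first index outside the range and contributes nothing.\<close>
  let ?e = "\<lambda>i j k. (i * dim2 t + j) * dim3 t + k"
  let ?A1 = "\<lambda>i l. if l div dim3 t div dim2 t = i then 1 else 0"
  let ?A2 = "\<lambda>j l. if l div dim3 t mod dim2 t = j then 1 else 0"
  let ?A3 = "\<lambda>k l. if l mod dim3 t = k
    then coord t (l div dim3 t div dim2 t) (l div dim3 t mod dim2 t) k else 0"
  have "coord t i j k = contract ?A1 ?A2 ?A3 (unit_tensor r) i j k"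
    if b: "i < dim1 t" "j < dim2 t" "k < dim3 t" for i j k
  proof -
    have e: "?e i j k < r"
      using b assms by (intro less_le_trans[OF pair_less[OF pair_less]])
    have "contract ?A1 ?A2 ?A3 (unit_tensor r) i j k =
      (\<Sum>p \<in> idx (unit_tensor r :: 'a tensor3). if p = (?e i j k, ?e i j k, ?e i j k) then coord t i j k else 0)"
      unfolding contract_def
    proof (rule sum.cong[OF refl], clarify)
      fix l l' l'' assume "(l, l', l'') \<in> idx (unit_tensor r :: 'a tensor3)"
      then have l: "l < r" "l' < r" "l'' < r" by (auto simp: idx_def)
      have "l = ?e i j k \<longleftrightarrow>
          l div dim3 t div dim2 t = i \<and> l div dim3 t mod dim2 t = j \<and> l mod dim3 t = k"
        using b div_mult_mod_eq[of l "dim3 t"] div_mult_mod_eq[of "l div dim3 t" "dim2 t"] by auto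
      then show "?A1 i l * ?A2 j l' * ?A3 k l'' * coord (unit_tensor r) l l' l'' =
        (if (l, l', l'') = (?e i j k, ?e i j k, ?e i j k) then coord t i j k else 0)"
        using l by (auto simp: coord_unit_tensor)
    qed
    also have "\<dots> = coord t i j k"
      using e by (simp add: idx_def)
    finally show ?thesis by simp
  qed
  then show ?thesis
    unfolding restricts_iff restr_by_def
    by (intro exI[of _ ?A1] exI[of _ ?A2] exI[of _ ?A3]) auto
qed

lemma monomially_restricts_restricts: "monomially_restricts t s \<Longrightarrow> restricts t s"
  unfolding monomially_restricts_iff restricts_iff by (rule linear.restr_by_of_monomial)

lemma restricts_trans: "restricts t s \<Longrightarrow> restricts s u \<Longrightarrow> restricts t u"
  unfolding restricts_iff by (rule linear.restr_by_trans)

lemma nonzero_unit: "nonzero (unit_tensor 2 :: 'a::field tensor3)"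
  by (auto simp: nonzero_def coord_unit_tensor intro!: exI[of _ 0])

lemma omega_unit_bounds:
  assumes "\<not> is_simple t"
  shows "1 \<le> omega (unit_tensor 2) t" "omega (unit_tensor 2) t < \<infinity>"
proof -
  note eq = omega_eq_INF[OF not_simple_nonzero[OF assms]]
  show "1 \<le> omega (unit_tensor 2) t"
    unfolding eq
  proof (rule INF_greatest, clarify)
    fix m n assume "(m, n) \<in> feasible restricts (unit_tensor 2) t"
    then have n: "1 \<le> n" and "restricts (unit_tensor (2 ^ m)) (kron_pow t n)"
      by (simp_all add: feasible_def kron_pow_unit)
    then have "(2::nat) ^ n \<le> 2 ^ m" using not_simple_restricts_pow[OF assms] by blast
    then have "n \<le> m" by simp
    then show "1 \<le> ereal (real m / real n)" using n by (simp add: one_ereal_def)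
  qed
  let ?d = "dim1 t * dim2 t * dim3 t"
  \<comment> \<open>Only finiteness is at stake, so the crude estimate \<open>?d < 2 ^ ?d\<close>
    suffices.\<close>
  have "restricts (unit_tensor (2 ^ ?d)) t"
    by (rule unit_restricts) (simp add: less_imp_le)
  then have "(?d, 1) \<in> feasible restricts (unit_tensor 2) t"
    by (simp add: feasible_def kron_pow_unit kron_unit_right[unfolded One_nat_def])
  then have "omega (unit_tensor 2) t \<le> ereal (real ?d / real 1)"
    unfolding eq by (rule INF_lower2) simp
  then show "omega (unit_tensor 2) t < \<infinity>"
    by (auto intro: le_less_trans)
qed

lemma irr_M_ge_1:
  assumes "\<not> is_simple t"
  shows "1 \<le> irr_M t"
proof -
  note nz = not_simple_nonzero[OF assms]
  obtain a where a: "omega (unit_tensor 2) t = ereal a" "a \<ge> 1"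
    using omega_unit_bounds[OF assms] by (cases "omega (unit_tensor 2) t") auto
  have "ereal (1 / a) \<le> omega_M t (unit_tensor 2)"
    unfolding omega_M_eq_INF[OF nonzero_unit]
  proof (rule INF_greatest, clarify)
    fix m n assume "(m, n) \<in> feasible monomially_restricts t (unit_tensor 2)"
    then have n: "1 \<le> n" and mn: "restricts (kron_pow t m) (kron_pow (unit_tensor 2) n)"
      by (simp_all add: feasible_def monomially_restricts_restricts)
    \<comment> \<open>Raising one relation to the power \<open>m\<close> and the other to
      \<open>n'\<close> makes them meet at the same power of \<open>t\<close>.\<close>
    have *: "m' * m \<ge> n * n'" if "(m', n') \<in> feasible restricts (unit_tensor 2) t" for m' n'
    proof -
      have "restricts (kron_pow (unit_tensor 2) m') (kron_pow t n')"
        using that by (simp add: feasible_def)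
      then have "restricts (kron_pow (unit_tensor 2) (m * m')) (kron_pow t (m * n'))"
        unfolding restricts_iff by (rule linear.restr_by_kron_pow_mult)
      moreover have "restricts (kron_pow t (n' * m)) (kron_pow (unit_tensor 2) (n' * n))"
        using mn unfolding restricts_iff by (rule linear.restr_by_kron_pow_mult)
      ultimately have "restricts (kron_pow (unit_tensor 2) (m * m') :: 'a tensor3)
          (kron_pow (unit_tensor 2) (n' * n))"
        by (metis restricts_trans mult.commute)
      then have "(2::nat) ^ (n' * n) \<le> 2 ^ (m * m')"
        unfolding kron_pow_unit by (rule restricts_unit_unit)
      then show ?thesis by (simp add: mult.commute)
    qed
    have "ereal (real n) \<le> ereal (real m) * omega (unit_tensor 2) t"
    proof (cases "m = 0")
      case True
      \<comment> \<open>With \<open>m = 0\<close> the inequality \<open>*\<close> leaves no feasible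
        pair, so the exponent would be \<infinity>, against its finiteness.\<close>
      have "(m', n') \<notin> feasible restricts (unit_tensor 2) t" for m' n'
        using *[of m' n'] n True by (auto simp: feasible_def)
      then have "feasible restricts (unit_tensor 2) t = {}" by auto
      then show ?thesis
        using a omega_eq_INF[OF nz, of "unit_tensor 2"] by (simp add: top_ereal_def)
    next
      case False
      have "ereal (real n / real m) \<le> omega (unit_tensor 2) t"
        unfolding omega_eq_INF[OF nz]
      proof (rule INF_greatest, clarify)
        fix m' n' assume f: "(m', n') \<in> feasible restricts (unit_tensor 2) t"
        then have "real n * real n' \<le> real m' * real m" "n' \<ge> 1"
          using *[OF f] by (simp_all flip: of_nat_mult add: feasible_def)
        then show "ereal (real n / real m) \<le> ereal (real m' / real n')"
          using False by (simp add: field_simps)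
      qed
      then show ?thesis using False by (simp add: a field_simps)
    qed
    then show "ereal (1 / a) \<le> ereal (real m / real n)"
      using a n by (simp add: field_simps)
  qed
  then have "ereal a * ereal (1 / a) \<le> irr_M t"
    unfolding irr_M_def a(1) using a(2) by (intro ereal_mult_left_mono) auto
  then show ?thesis using a(2) by (simp add: one_ereal_def)
qed

section \<open>Subtensors\<close>

text \<open>Index sets of arbitrary type allow structured labels, such as a block number with two
  matrix indices, in place of numerical codes.\<close>

definition contains ::
  "'a tensor3 \<Rightarrow> 'x set \<Rightarrow> 'y set \<Rightarrow> 'z set \<Rightarrow> ('x \<Rightarrow> 'y \<Rightarrow> 'z \<Rightarrow> 'a) \<Rightarrow> bool" where
  "contains t I J K f \<longleftrightarrow> (\<exists>p q r. inj_on p I \<and> inj_on q J \<and> inj_on r K \<and>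
     p ` I \<subseteq> {..<dim1 t} \<and> q ` J \<subseteq> {..<dim2 t} \<and> r ` K \<subseteq> {..<dim3 t} \<and>
     (\<forall>x\<in>I. \<forall>y\<in>J. \<forall>z\<in>K. coord t (p x) (q y) (r z) = f x y z))"

lemma containsE:
  assumes "contains t I J K f"
  obtains p q r where "inj_on p I" "inj_on q J" "inj_on r K"
    "p ` I \<subseteq> {..<dim1 t}" "q ` J \<subseteq> {..<dim2 t}" "r ` K \<subseteq> {..<dim3 t}"
    "\<And>x y z. x \<in> I \<Longrightarrow> y \<in> J \<Longrightarrow> z \<in> K \<Longrightarrow> coord t (p x) (q y) (r z) = f x y z"
proof -
  obtain p q r where *: "inj_on p I \<and> inj_on q J \<and> inj_on r K \<and>
     p ` I \<subseteq> {..<dim1 t} \<and> q ` J \<subseteq> {..<dim2 t} \<and> r ` K \<subseteq> {..<dim3 t} \<and>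
     (\<forall>x\<in>I. \<forall>y\<in>J. \<forall>z\<in>K. coord t (p x) (q y) (r z) = f x y z)"
    using assms unfolding contains_def by (elim exE) (rule that)
  show thesis
    by (rule that[of p q r]) (use * in auto)
qed

lemma contains_reindex:
  assumes "contains t I J K f"
    and inj: "inj_on u I'" "inj_on v J'" "inj_on w K'"
    and im: "u ` I' \<subseteq> I" "v ` J' \<subseteq> J" "w ` K' \<subseteq> K"
    and f: "\<And>x y z. x \<in> I' \<Longrightarrow> y \<in> J' \<Longrightarrow> z \<in> K' \<Longrightarrow> f' x y z = f (u x) (v y) (w z)"
  shows "contains t I' J' K' f'"
proof -
  obtain p q r where *: "inj_on p I" "inj_on q J" "inj_on r K"
      "p ` I \<subseteq> {..<dim1 t}" "q ` J \<subseteq> {..<dim2 t}" "r ` K \<subseteq> {..<dim3 t}"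
    and c: "\<And>x y z. x \<in> I \<Longrightarrow> y \<in> J \<Longrightarrow> z \<in> K \<Longrightarrow> coord t (p x) (q y) (r z) = f x y z"
    using assms(1) by (rule containsE) blast
  have "inj_on (p \<circ> u) I'" "inj_on (q \<circ> v) J'" "inj_on (r \<circ> w) K'"
    using * inj im by (meson comp_inj_on inj_on_subset)+
  then show ?thesis
    unfolding contains_def using * im
    by (intro exI[of _ "p \<circ> u"] exI[of _ "q \<circ> v"] exI[of _ "r \<circ> w"])
      (auto simp: f c image_subset_iff)
qed

lemma div_mod_eq_iff: "x div k = y div k \<and> x mod k = y mod k \<longleftrightarrow> x = y" for x y k :: nat
  by (metis div_mult_mod_eq)

lemma pair_eq_iff: "x * n + y = i * n + j \<longleftrightarrow> x = i \<and> y = j" if "y < n" "j < n" for x y i j n :: nat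
proof
  assume eq: "x * n + y = i * n + j"
  have "x = (x * n + y) div n" using that by simp
  also have "\<dots> = i" unfolding eq using that by simp
  finally show "x = i \<and> y = j" using eq by simp
qed simp

lemma inj_on_pair:
  assumes "inj_on p I" "inj_on p' I'" "p' ` I' \<subseteq> {..<d :: nat}"
  shows "inj_on (\<lambda>(x, x'). p x * d + p' x') (I \<times> I')"
proof (rule inj_onI, clarify)
  fix x x' y y' assume *: "x \<in> I" "x' \<in> I'" "y \<in> I" "y' \<in> I'"
    and eq: "p x * d + p' x' = p y * d + p' y'"
  then have b: "p' x' < d" "p' y' < d" using assms(3) by auto
  with eq have "p x = p y \<and> p' x' = p' y'"
    by (simp only: pair_eq_iff)
  then show "x = y \<and> x' = y'"
    using * assms(1,2) by (auto dest: inj_onD)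
qed

lemma contains_kron:
  assumes "contains t I J K f" "contains s I' J' K' f'"
  shows "contains (kron t s) (I \<times> I') (J \<times> J') (K \<times> K')
    (\<lambda>(x, x') (y, y') (z, z'). f x y z * f' x' y' z')"
proof -
  obtain p q r where 1: "inj_on p I" "inj_on q J" "inj_on r K"
      "p ` I \<subseteq> {..<dim1 t}" "q ` J \<subseteq> {..<dim2 t}" "r ` K \<subseteq> {..<dim3 t}"
    and c: "\<And>x y z. x \<in> I \<Longrightarrow> y \<in> J \<Longrightarrow> z \<in> K \<Longrightarrow> coord t (p x) (q y) (r z) = f x y z"
    using assms(1) by (rule containsE) blast
  obtain p' q' r' where 2: "inj_on p' I'" "inj_on q' J'" "inj_on r' K'"
      "p' ` I' \<subseteq> {..<dim1 s}" "q' ` J' \<subseteq> {..<dim2 s}" "r' ` K' \<subseteq> {..<dim3 s}"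
    and c': "\<And>x y z. x \<in> I' \<Longrightarrow> y \<in> J' \<Longrightarrow> z \<in> K' \<Longrightarrow> coord s (p' x) (q' y) (r' z) = f' x y z"
    using assms(2) by (rule containsE) blast
  show ?thesis
    unfolding contains_def
  proof (intro exI conjI)
    show "inj_on (\<lambda>(x, x'). p x * dim1 s + p' x') (I \<times> I')"
      "inj_on (\<lambda>(x, x'). q x * dim2 s + q' x') (J \<times> J')"
      "inj_on (\<lambda>(x, x'). r x * dim3 s + r' x') (K \<times> K')"
      using 1 2 by (auto intro: inj_on_pair)
    show "(\<lambda>(x, x'). p x * dim1 s + p' x') ` (I \<times> I') \<subseteq> {..<dim1 (kron t s)}"
      "(\<lambda>(x, x'). q x * dim2 s + q' x') ` (J \<times> J') \<subseteq> {..<dim2 (kron t s)}"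
      "(\<lambda>(x, x'). r x * dim3 s + r' x') ` (K \<times> K') \<subseteq> {..<dim3 (kron t s)}"
      using 1(4-6) 2(4-6) by (auto simp: image_subset_iff intro!: pair_less)
    show "\<forall>x\<in>I \<times> I'. \<forall>y\<in>J \<times> J'. \<forall>z\<in>K \<times> K'.
        coord (kron t s) ((\<lambda>(x, x'). p x * dim1 s + p' x') x)
          ((\<lambda>(x, x'). q x * dim2 s + q' x') y) ((\<lambda>(x, x'). r x * dim3 s + r' x') z)
        = (\<lambda>(x, x') (y, y') (z, z'). f x y z * f' x' y' z') x y z"
      using 1(4-6) 2(4-6) by (auto simp: image_subset_iff coord_kron_pair c c')
  qed
qed

lemma contains_monomially_restricts_unit:
  assumes "contains t {..<r} {..<r} {..<r} (\<lambda>i j k. if i = j \<and> j = k then 1 else 0)"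
  shows "monomially_restricts t (unit_tensor r)"
proof -
  obtain p q s where "inj_on p {..<r}" "inj_on q {..<r}" "inj_on s {..<r}"
      "p ` {..<r} \<subseteq> {..<dim1 t}" "q ` {..<r} \<subseteq> {..<dim2 t}" "s ` {..<r} \<subseteq> {..<dim3 t}"
      "\<And>x y z. x < r \<Longrightarrow> y < r \<Longrightarrow> z < r \<Longrightarrow>
        coord t (p x) (q y) (s z) = (if x = y \<and> y = z then 1 else 0)"
    using assms by (rule containsE) auto
  then show ?thesis
    unfolding monomially_restricts_iff
    by (intro restr_by_select[where ea = p and eb = q and ec = s and c = "\<lambda>_. 1"])
      (auto simp: coord_unit_tensor)
qed

text \<open>The subtensor is \<langle>a\<rangle> \<otimes> \<langle>n,n,n\<rangle>, a direct sum of
  \<open>a\<close> matrix multiplication tensors, with \<open>l\<close> the number of the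
  summand.\<close>

definition contains_unit_matmul :: "'a::semiring_1 tensor3 \<Rightarrow> nat \<Rightarrow> nat \<Rightarrow> bool" where
  "contains_unit_matmul t a n \<longleftrightarrow> contains t ({..<a} \<times> {..<n} \<times> {..<n})
     ({..<a} \<times> {..<n} \<times> {..<n}) ({..<a} \<times> {..<n} \<times> {..<n})
     (\<lambda>(l, x, y) (l', y', z) (l'', z', x').
        if l = l' \<and> l' = l'' \<and> x = x' \<and> y = y' \<and> z = z' then 1 else 0)"

text \<open>Block numbers and matrix indices of the product are two-digit numbers, and two of them
  agree exactly when both digits do. This turns the product of two indicator functions into a single
  one.\<close>

lemma contains_unit_matmul_kron:
  fixes t s :: "'a::semiring_1 tensor3"
  assumes "contains_unit_matmul t a n" "contains_unit_matmul s b m"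
  shows "contains_unit_matmul (kron t s) (a * b) (n * m)"
  unfolding contains_unit_matmul_def
proof (rule contains_reindex[OF contains_kron[OF assms[unfolded contains_unit_matmul_def]]])
  let ?u = "\<lambda>(l, x, y). ((l div b, x div m, y div m), (l mod b, x mod m, y mod m))"
  have "inj ?u"
    by (rule injI) (clarsimp, metis div_mod_eq_iff)
  then show "inj_on ?u ({..<a * b} \<times> {..<n * m} \<times> {..<n * m})"
    "inj_on ?u ({..<a * b} \<times> {..<n * m} \<times> {..<n * m})"
    "inj_on ?u ({..<a * b} \<times> {..<n * m} \<times> {..<n * m})"
    by (auto intro: inj_on_subset)
  show "?u ` ({..<a * b} \<times> {..<n * m} \<times> {..<n * m}) \<subseteq>
      ({..<a} \<times> {..<n} \<times> {..<n}) \<times> ({..<b} \<times> {..<m} \<times> {..<m})"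
    "?u ` ({..<a * b} \<times> {..<n * m} \<times> {..<n * m}) \<subseteq>
      ({..<a} \<times> {..<n} \<times> {..<n}) \<times> ({..<b} \<times> {..<m} \<times> {..<m})"
    "?u ` ({..<a * b} \<times> {..<n * m} \<times> {..<n * m}) \<subseteq>
      ({..<a} \<times> {..<n} \<times> {..<n}) \<times> ({..<b} \<times> {..<m} \<times> {..<m})"
    by (auto simp: less_mult_imp_div_less mod_less_of_mult)
next
  fix p q r :: "nat \<times> nat \<times> nat"
  obtain l x y l' y' z l'' z' x' where pqr: "p = (l, x, y)" "q = (l', y', z)" "r = (l'', z', x')"
    by (metis prod_cases3)
  have c: "l = l' \<and> l' = l'' \<and> x = x' \<and> y = y' \<and> z = z' \<longleftrightarrow>
    (l div b = l' div b \<and> l' div b = l'' div b \<and> x div m = x' div m \<and> y div m = y' div m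
      \<and> z div m = z' div m) \<and>
    (l mod b = l' mod b \<and> l' mod b = l'' mod b \<and> x mod m = x' mod m \<and> y mod m = y' mod m
      \<and> z mod m = z' mod m)"
    using div_mod_eq_iff[of l b l'] div_mod_eq_iff[of l' b l''] div_mod_eq_iff[of x m x']
      div_mod_eq_iff[of y m y'] div_mod_eq_iff[of z m z']
    by satx
  show "(case p of (l, x, y) \<Rightarrow> \<lambda>(l', y', z) (l'', z', x').
      if l = l' \<and> l' = l'' \<and> x = x' \<and> y = y' \<and> z = z' then (1 :: 'a) else 0) q r =
    (\<lambda>(x, x') (y, y') (z, z').
      (\<lambda>(l, x, y) (l', y', z) (l'', z', x').
        if l = l' \<and> l' = l'' \<and> x = x' \<and> y = y' \<and> z = z' then (1 :: 'a) else 0) x y z *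
      (\<lambda>(l, x, y) (l', y', z) (l'', z', x').
        if l = l' \<and> l' = l'' \<and> x = x' \<and> y = y' \<and> z = z' then (1 :: 'a) else 0) x' y' z')
      (case p of (l, x, y) \<Rightarrow> ((l div b, x div m, y div m), (l mod b, x mod m, y mod m)))
      (case q of (l, x, y) \<Rightarrow> ((l div b, x div m, y div m), (l mod b, x mod m, y mod m)))
      (case r of (l, x, y) \<Rightarrow> ((l div b, x div m, y div m), (l mod b, x mod m, y mod m)))"
    unfolding pqr prod.case c by (simp split: if_split)
qed

lemma contains_unit_matmul_unit: "contains_unit_matmul (unit_tensor a) a 1"
  unfolding contains_unit_matmul_def contains_def
  by (intro exI[of _ fst]) (auto simp: coord_unit_tensor inj_on_def)

lemma contains_unit_matmul_kron_pow:
  "contains_unit_matmul t a n \<Longrightarrow> contains_unit_matmul (kron_pow t m) (a ^ m) (n ^ m)"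
  using contains_unit_matmul_unit[of 1]
  by (induction m) (auto intro: contains_unit_matmul_kron)

lemma coord_matmul_tensor:
  assumes "x < n" "y < n" "z < n" "x' < n" "y' < n" "z' < n"
  shows "coord (matmul_tensor n n n) (x * n + y) (y' * n + z) (z' * n + x')
    = (if x = x' \<and> y = y' \<and> z = z' then 1 else 0)"
proof -
  have "coord (matmul_tensor n n n) (x * n + y) (y' * n + z) (z' * n + x')
    = (\<Sum>(i, j, k) \<in> {..<n} \<times> {..<n} \<times> {..<n}. if x * n + y = i * n + j \<and>
        y' * n + z = j * n + k \<and> z' * n + x' = k * n + i then 1 else 0)"
    unfolding matmul_tensor_def using assms
    by (simp add: pair_less sum.cartesian_product)
  also have "\<dots> = (\<Sum>w \<in> {..<n} \<times> {..<n} \<times> {..<n}. if w = (x, y, z)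
      then (if x = x' \<and> y = y' \<and> z = z' then 1 else 0) else 0)"
    by (rule sum.cong[OF refl]) (auto simp: pair_eq_iff assms split: if_splits)
  also have "\<dots> = (if x = x' \<and> y = y' \<and> z = z' then 1 else 0)"
    using assms by simp
  finally show ?thesis .
qed

lemma contains_unit_matmul_matmul: "contains_unit_matmul (matmul_tensor n n n) 1 n"
proof -
  have inj: "inj_on (\<lambda>(l, x, y). x * n + y) ({..<1::nat} \<times> {..<n} \<times> {..<n})"
    using inj_on_pair[of id "{..<n}" id "{..<n}" n]
    by (auto simp: inj_on_def)
  have "(\<lambda>(l, x, y). x * n + y) ` ({..<1::nat} \<times> {..<n} \<times> {..<n}) \<subseteq> {..<n * n}"
    by (auto simp: pair_less)
  with inj show ?thesis
    unfolding contains_unit_matmul_def contains_def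
    by (intro exI[of _ "\<lambda>(l, x, y). x * n + y"])
      (auto simp: coord_matmul_tensor matmul_tensor_def[THEN arg_cong[of _ _ dim1]]
        matmul_tensor_def[THEN arg_cong[of _ _ dim2]] matmul_tensor_def[THEN arg_cong[of _ _ dim3]])
qed

section \<open>Rigid families of triples\<close>

text \<open>
  A rigid family of \<open>r\<close> triples selects a diagonal of size \<open>r\<close> in the matrix multiplication tensor:
  position 1 keeps \<open>e_(X a, Y a)\<close>, position 2 keeps \<open>e_(Y a, Z a)\<close>, position 3 keeps
  \<open>e_(Z a, X a)\<close>. Taking \<open>b = c\<close> and its two analogues shows that each pair of coordinates
  determines the triple.
\<close>

definition rigid :: "'i set \<Rightarrow> ('i \<Rightarrow> 'v) \<Rightarrow> ('i \<Rightarrow> 'v) \<Rightarrow> ('i \<Rightarrow> 'v) \<Rightarrow> bool" where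
  "rigid I X Y Z \<longleftrightarrow> (\<forall>a\<in>I. \<forall>b\<in>I. \<forall>c\<in>I. X a = X c \<longrightarrow> Y a = Y b \<longrightarrow> Z b = Z c \<longrightarrow> a = b \<and> b = c)"

text \<open>The \<open>a\<close> summands are disjoint in all three positions, so the same family is
  used in each: label \<open>i\<close> stands for triple \<open>i mod r\<close> in block
  \<open>i div r\<close>. A selected coordinate is 1 exactly when the blocks agree and the triples
  overlap as in the premises of \<open>rigid\<close>.\<close>

lemma rigid_monomially_restricts:
  assumes t: "contains_unit_matmul t a n"
    and rigid: "rigid {..<r} X Y Z"
    and im: "X ` {..<r} \<subseteq> {..<n}" "Y ` {..<r} \<subseteq> {..<n}" "Z ` {..<r} \<subseteq> {..<n}"
  shows "monomially_restricts t (unit_tensor (a * r))"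
proof (rule contains_monomially_restricts_unit)
  let ?u = "\<lambda>X Y i. (i div r, X (i mod r), Y (i mod r))"
  have R: "i = j \<and> j = k" if "i < a * r" "j < a * r" "k < a * r"
    "i div r = j div r" "j div r = k div r"
    "X (i mod r) = X (k mod r)" "Y (i mod r) = Y (j mod r)" "Z (j mod r) = Z (k mod r)" for i j k
  proof -
    have "i mod r = j mod r \<and> j mod r = k mod r"
      using that rigid[unfolded rigid_def, rule_format, of "i mod r" "j mod r" "k mod r"]
      by (simp add: mod_less_of_mult)
    then show ?thesis using that(4,5) by (metis div_mult_mod_eq)
  qed
  show "contains t {..<a * r} {..<a * r} {..<a * r} (\<lambda>i j k. if i = j \<and> j = k then 1 else 0)"
  proof (rule contains_reindex[OF t[unfolded contains_unit_matmul_def]])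
    show "inj_on (?u X Y) {..<a * r}"
    proof (rule inj_onI)
      fix i j assume "i \<in> {..<a * r}" "j \<in> {..<a * r}" "?u X Y i = ?u X Y j"
      then have "i < a * r" "j < a * r" "i div r = j div r" "X (i mod r) = X (j mod r)"
        "Y (i mod r) = Y (j mod r)" by simp_all
      then show "i = j" using R[of i j j] by metis
    qed
    show "inj_on (?u Y Z) {..<a * r}"
    proof (rule inj_onI)
      fix i j assume "i \<in> {..<a * r}" "j \<in> {..<a * r}" "?u Y Z i = ?u Y Z j"
      then have "i < a * r" "j < a * r" "i div r = j div r" "Y (i mod r) = Y (j mod r)"
        "Z (i mod r) = Z (j mod r)" by simp_all
      then show "i = j" using R[of i j i] by metis
    qed
    show "inj_on (?u Z X) {..<a * r}"
    proof (rule inj_onI)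
      fix i j assume "i \<in> {..<a * r}" "j \<in> {..<a * r}" "?u Z X i = ?u Z X j"
      then have "i < a * r" "j < a * r" "i div r = j div r" "Z (i mod r) = Z (j mod r)"
        "X (i mod r) = X (j mod r)" by simp_all
      then show "i = j" using R[of i i j] by metis
    qed
    show "?u X Y ` {..<a * r} \<subseteq> {..<a} \<times> {..<n} \<times> {..<n}"
      "?u Y Z ` {..<a * r} \<subseteq> {..<a} \<times> {..<n} \<times> {..<n}"
      "?u Z X ` {..<a * r} \<subseteq> {..<a} \<times> {..<n} \<times> {..<n}"
      using im by (auto simp: less_mult_imp_div_less mod_less_of_mult image_subset_iff)
  next
    fix i j k assume "i \<in> {..<a * r}" "j \<in> {..<a * r}" "k \<in> {..<a * r}"
    then have "i = j \<and> j = k \<longleftrightarrow> i div r = j div r \<and> j div r = k div r \<and>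
        X (i mod r) = X (k mod r) \<and> Y (i mod r) = Y (j mod r) \<and> Z (j mod r) = Z (k mod r)"
      using R[of i j k] by blast
    then show "(if i = j \<and> j = k then 1 else 0) =
      (\<lambda>(l, x, y) (l', y', z) (l'', z', x').
        if l = l' \<and> l' = l'' \<and> x = x' \<and> y = y' \<and> z = z' then 1 else 0)
        (?u X Y i) (?u Y Z j) (?u Z X k)"
      by simp
  qed
qed

section \<open>Behrend-type families of triples\<close>

text \<open>The triangle consists of the pairs that extend, uniquely, to a triple of naturals with
  sum \<open>g\<close>.\<close>

lemma twice_card_triangle: "2 * card (SIGMA a:{..g}. {..g - a}) = (g + 1) * (g + 2)"
proof -
  have "2 * (\<Sum>a\<le>n. n - a + 1) = (n + 1) * (n + 2)" for n :: nat
  proof (induction n)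
    case (Suc n)
    then show ?case by (subst sum.atMost_Suc_shift) (simp add: algebra_simps)
  qed simp
  then show ?thesis by (simp add: card_SigmaI)
qed

text \<open>
  Behrend's argument in the form used by Strassen: for \<open>x\<close>, \<open>y\<close>, \<open>z\<close> in the box \<open>{0..g}^d\<close>, the sum
  of \<open>(x l + y l + z l - g)^2\<close> splits into a function of \<open>(x, y)\<close>, one of \<open>(y, z)\<close> and one of
  \<open>(z, x)\<close>. Among the triples with \<open>x + y + z = g\<close>, where the three functions add up to \<open>0\<close>, take
  those with the most popular values \<open>(- U, - W)\<close> of the first two. If three of them overlap in a
  triple \<open>(x, y, z)\<close>, then the sum of squares vanishes there, so \<open>x + y + z = g\<close>. A triple is encoded
  by \<open>l \<mapsto> (x l, y l)\<close>.
\<close>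

lemma exists_rigid_family:
  fixes g d :: nat
  shows "\<exists>(I :: (nat \<Rightarrow> nat \<times> nat) set) X Y Z. finite I \<and> rigid I X Y Z \<and>
    X ` I \<subseteq> PiE {..<d} (\<lambda>_. {..g}) \<and> Y ` I \<subseteq> PiE {..<d} (\<lambda>_. {..g}) \<and>
    Z ` I \<subseteq> PiE {..<d} (\<lambda>_. {..g}) \<and>
    ((g + 1) * (g + 2) div 2) ^ d \<le> card I * (g * g * d + 1)\<^sup>2"
proof -
  define E where "E = (SIGMA a:{..g}. {..g - a})"
  define S where "S = PiE {..<d} (\<lambda>_. E)"
  define third where "third = (\<lambda>(a, b). g - a - b)"
  \<comment> \<open>Expanding gives (x + y + z - g)^2 = g^2 - x(2g - x - 2y) - y(2g - y - 2z) - z(2g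
    - z - 2x); \<open>u\<close> and \<open>w\<close> are the first two subtracted terms. Truncated
    subtraction is exact on \<open>E\<close>.\<close>
  define u where "u = (\<lambda>(a, b). a * (2 * g - a - 2 * b))"
  define w where "w e = snd e * (2 * g - snd e - 2 * third e)" for e
  define U W where "U s = (\<Sum>l<d. u (s l))" and "W s = (\<Sum>l<d. w (s l))" for s :: "nat \<Rightarrow> nat \<times> nat"
  have E: "fst e + snd e \<le> g" if "e \<in> E" for e
    using that by (auto simp: E_def)
  have bound: "a * (2 * g - a - 2 * b) \<le> g * g" for a b :: nat
  proof -
    have "a * (2 * g - a) \<le> g * g"
    proof (cases "a \<le> 2 * g")
      case True
      have "0 \<le> (int a - int g)\<^sup>2" by simp
      also have "(int a - int g)\<^sup>2 = int g * int g - int a * (2 * int g - int a)"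
        by (simp add: power2_eq_square algebra_simps)
      finally have "int (a * (2 * g - a)) \<le> int (g * g)"
        using True by (simp add: of_nat_diff)
      then show ?thesis by linarith
    qed simp
    moreover have "a * (2 * g - a - 2 * b) \<le> a * (2 * g - a)"
      by (intro mult_le_mono2 diff_le_self)
    ultimately show ?thesis by linarith
  qed
  have uw: "u e \<le> g * g" "w e \<le> g * g" for e
    unfolding u_def w_def by (simp_all add: case_prod_unfold bound del: diff_diff_left)
  have "U s \<le> (\<Sum>l<d. g * g)" "W s \<le> (\<Sum>l<d. g * g)" for s
    unfolding U_def W_def by (intro sum_mono uw)+
  then have "(\<lambda>s. (U s, W s)) \<in> S \<rightarrow> {..g * g * d} \<times> {..g * g * d}"
    by (auto simp: mult_ac)
  moreover have fin: "finite S"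
    unfolding S_def E_def by (intro finite_PiE) auto
  ultimately obtain c where c: "card S \<le> card ((\<lambda>s. (U s, W s)) -` {c} \<inter> S) * (g * g * d + 1)\<^sup>2"
    using pigeonhole_card[of "\<lambda>s. (U s, W s)" S "{..g * g * d} \<times> {..g * g * d}"]
    by (auto simp: power2_eq_square)
  define I where "I = (\<lambda>s. (U s, W s)) -` {c} \<inter> S"
  define X Y Z :: "(nat \<Rightarrow> nat \<times> nat) \<Rightarrow> nat \<Rightarrow> nat" where
    "X s = (\<lambda>l\<in>{..<d}. fst (s l))" and "Y s = (\<lambda>l\<in>{..<d}. snd (s l))"
    and "Z s = (\<lambda>l\<in>{..<d}. third (s l))" for s
  have "s1 = s2 \<and> s2 = s3" if "s1 \<in> I" "s2 \<in> I" "s3 \<in> I"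
    and eq: "X s1 = X s3" "Y s1 = Y s2" "Z s2 = Z s3" for s1 s2 s3
  proof -
    have S: "s1 \<in> S" "s2 \<in> S" "s3 \<in> S" and UW: "U s1 = U s3" "W s2 = W s3"
      using that(1-3) by (auto simp: I_def)
    have sl: "fst (s1 l) = fst (s3 l)" "snd (s1 l) = snd (s2 l)" "third (s2 l) = third (s3 l)"
      "s1 l \<in> E" "s2 l \<in> E" "s3 l \<in> E"
      if "l < d" for l
      using fun_cong[OF eq(1), of l] fun_cong[OF eq(2), of l] fun_cong[OF eq(3), of l] that S
      by (auto simp: X_def Y_def Z_def S_def PiE_mem)
    \<comment> \<open>The part depending on (z, x) is read off from \<open>s3\<close>: there the
      coordinates sum to \<open>g\<close>, the square is 0, and that part equals
      \<open>u + w\<close>.\<close>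
    have "(int (fst (s1 l)) + int (snd (s1 l)) + int (third (s2 l)) - int g)\<^sup>2
        = int (u (s3 l)) + int (w (s3 l)) - int (u (s1 l)) - int (w (s2 l))" if "l < d" for l
    proof -
      obtain a b where 1: "s1 l = (a, b)" by fastforce
      obtain a' b' where 2: "s2 l = (a', b')" by fastforce
      obtain a'' b'' where 3: "s3 l = (a'', b'')" by fastforce
      note * = sl[OF that, unfolded 1 2 3, simplified]
      have le: "a + b \<le> g" "a' + b' \<le> g" "a'' + b'' \<le> g"
        using *(4-6)[THEN E] by simp_all
      define k where "k = g - a' - b'"
      have k: "int k = int g - int a' - int b'" "int k = int g - int a'' - int b''"
        using le *(3) by (simp_all add: k_def third_def)
      have u: "int (u (x, y)) = int x * (2 * int g - int x - 2 * int y)" if "x + y \<le> g" for x y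
        using that by (simp add: u_def of_nat_diff)
      have w: "int (w (x, y)) = int y * (2 * int g - int y - 2 * (int g - int x - int y))"
        if "x + y \<le> g" for x y
        using that by (simp add: w_def third_def of_nat_diff)
      have "int a = int a''" "int b = int b'" using *(1,2) by simp_all
      moreover have "int a' = int g - int b - int k" "int b'' = int g - int a - int k"
        using k *(1,2) by simp_all
      ultimately show ?thesis
        unfolding 1 2 3 u[OF le(1)] u[OF le(3)] w[OF le(2)] w[OF le(3)]
        by (simp add: third_def flip: k_def) (simp add: power2_eq_square algebra_simps)
    qed
    then have "(\<Sum>l<d. (int (fst (s1 l)) + int (snd (s1 l)) + int (third (s2 l)) - int g)\<^sup>2)
        = (\<Sum>l<d. int (u (s3 l)) + int (w (s3 l)) - int (u (s1 l)) - int (w (s2 l)))"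
      by (intro sum.cong) auto
    also have "\<dots> = int (U s3) + int (W s3) - int (U s1) - int (W s2)"
      by (simp add: U_def W_def sum.distrib sum_subtractf)
    also have "\<dots> = 0" using UW by simp
    finally have sq: "int (fst (s1 l)) + int (snd (s1 l)) + int (third (s2 l)) - int g = 0"
      if "l < d" for l
      using that by (subst (asm) sum_nonneg_eq_0_iff) auto
    \<comment> \<open>At each \<open>l\<close> the three entries share x, y, z with sum
      \<open>g\<close>; each contains two of these numbers, and the sum fixes its third.\<close>
    have "s1 l = s2 l \<and> s2 l = s3 l" if "l < d" for l
      using sq[OF that] sl[OF that] sl(4-6)[OF that, THEN E]
      by (auto simp: third_def prod_eq_iff case_prod_unfold)
    then show ?thesis
      using S unfolding S_def by (metis PiE_ext lessThan_iff)
  qed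
  then have "rigid I X Y Z"
    unfolding rigid_def by blast
  moreover have "X ` I \<subseteq> PiE {..<d} (\<lambda>_. {..g})" "Y ` I \<subseteq> PiE {..<d} (\<lambda>_. {..g})"
    "Z ` I \<subseteq> PiE {..<d} (\<lambda>_. {..g})"
    by (fastforce simp: I_def S_def X_def Y_def Z_def third_def case_prod_unfold dest: PiE_mem E)+
  moreover have "card S = ((g + 1) * (g + 2) div 2) ^ d"
  proof -
    have "card E = (g + 1) * (g + 2) div 2"
      unfolding E_def twice_card_triangle[symmetric] by simp
    then show ?thesis by (simp only: S_def card_PiE finite_lessThan prod_constant card_lessThan)
  qed
  ultimately show ?thesis
    using c fin unfolding I_def[symmetric]
    by (intro exI[of _ I] exI[of _ X] exI[of _ Y] exI[of _ Z]) (auto simp: I_def)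
qed

text \<open>With \<open>g + 1 = 2 ^ p\<close> and dimension \<open>p\<close> the box has
  \<open>2 ^ (p * p)\<close> points. The triangle has at least \<open>2 ^ (2 * p - 1)\<close> pairs,
  so halving costs \<open>p\<close> in the exponent of the \<open>p\<close>-th power. Choosing the
  popular value costs \<open>6 * p\<close>, since \<open>g * g * p + 1 \<le> 2 ^ (3 * p)\<close>.
  Together this is \<open>7 * p\<close>, of lower order than \<open>p * p\<close>.\<close>

lemma exists_rigid_family_nat:
  assumes "p \<ge> 1"
  shows "\<exists>X Y Z. rigid {..<2 ^ (2 * p * p - 7 * p) :: nat} X Y Z \<and>
    X ` {..<2 ^ (2 * p * p - 7 * p) :: nat} \<subseteq> {..<2 ^ (p * p) :: nat} \<and>
    Y ` {..<2 ^ (2 * p * p - 7 * p) :: nat} \<subseteq> {..<2 ^ (p * p) :: nat} \<and>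
    Z ` {..<2 ^ (2 * p * p - 7 * p) :: nat} \<subseteq> {..<2 ^ (p * p) :: nat}"
proof -
  let ?r = "2 ^ (2 * p * p - 7 * p) :: nat"
  define g :: nat where "g = 2 ^ p - 1"
  have g: "g + 1 = 2 ^ p" by (simp add: g_def)
  let ?V = "PiE {..<p} (\<lambda>_. {..g})"
  obtain I :: "(nat \<Rightarrow> nat \<times> nat) set" and X Y Z where I: "finite I" "rigid I X Y Z"
    and im: "X ` I \<subseteq> ?V" "Y ` I \<subseteq> ?V" "Z ` I \<subseteq> ?V"
    and card: "((g + 1) * (g + 2) div 2) ^ p \<le> card I * (g * g * p + 1)\<^sup>2"
    using exists_rigid_family[of p g] by metis
  have "?r \<le> card I"
  proof -
    have "Suc (2 * p - 1) = p + p" using assms by simp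
    then have "2 * (2::nat) ^ (2 * p - 1) = 2 ^ p * 2 ^ p"
      by (metis power_Suc power_add)
    then have "(2::nat) ^ (2 * p - 1) = 2 ^ p * 2 ^ p div 2" by linarith
    also have "\<dots> \<le> (g + 1) * (g + 2) div 2"
      unfolding g by (intro div_le_mono mult_le_mono) (use g in auto)
    finally have "((2::nat) ^ (2 * p - 1)) ^ p \<le> card I * (g * g * p + 1)\<^sup>2"
      using card by (meson power_mono le_trans zero_le)
    also have "g * g * p + 1 \<le> 2 ^ (3 * p)"
    proof -
      have "g * g * p + 1 \<le> (g + 1) * (g + 1) * p"
        using assms by (simp add: algebra_simps)
      also have "\<dots> \<le> 2 ^ p * 2 ^ p * 2 ^ p"
        unfolding g by (intro mult_le_mono) (auto simp: less_imp_le)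
      also have "\<dots> = 2 ^ (3 * p)"
        by (simp flip: power_add)
      finally show ?thesis .
    qed
    then have "card I * (g * g * p + 1)\<^sup>2 \<le> card I * (2 ^ (3 * p))\<^sup>2"
      by (intro mult_le_mono power_mono) auto
    \<comment> \<open>The extra factor \<open>2 ^ p\<close> cancels the halving, since
      \<open>p + (2 * p - 1) * p = 2 * p * p\<close>.\<close>
    finally have "2 ^ p * ((2::nat) ^ (2 * p - 1)) ^ p \<le> 2 ^ p * (card I * (2 ^ (3 * p))\<^sup>2)"
      by simp
    moreover have "2 ^ p * ((2::nat) ^ (2 * p - 1)) ^ p = 2 ^ (2 * p * p)"
    proof -
      have "p + (2 * p - 1) * p = 2 * p * p"
        using assms by (cases p) (simp_all add: algebra_simps)
      then show ?thesis by (simp flip: power_mult power_add)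
    qed
    moreover have "2 ^ p * (card I * (2 ^ (3 * p))\<^sup>2) = card I * 2 ^ (7 * p)"
      by (simp add: mult.left_commute flip: power_mult power_add)
    ultimately have *: "2 ^ (2 * p * p) \<le> card I * 2 ^ (7 * p)" by simp
    show ?thesis
    proof (cases "7 * p \<le> 2 * p * p")
      case True
      then have "?r * 2 ^ (7 * p) = 2 ^ (2 * p * p)" by (simp flip: power_add)
      then show ?thesis using * by (metis mult_le_cancel2 zero_less_numeral zero_less_power)
    next
      \<comment> \<open>For small \<open>p\<close> the exponent is truncated to 0 and it only
        remains to see that \<open>I\<close> is nonempty.\<close>
      case False
      then show ?thesis using * by (cases "card I") auto
    qed
  qed
  moreover obtain e where e: "bij_betw e {0..<card I} I"
    using ex_bij_betw_nat_finite[OF I(1)] by blast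
  ultimately have e_I: "e i \<in> I" if "i < ?r" for i
    using that by (auto dest!: bij_betwE)
  have e_inj: "i = j" if "e i = e j" "i < ?r" "j < ?r" for i j
    using that \<open>?r \<le> card I\<close> bij_betw_imp_inj_on[OF e] by (auto dest!: inj_onD)
  have "finite ?V" by (intro finite_PiE) auto
  moreover have "card ?V = 2 ^ (p * p)"
    by (simp add: card_PiE g[simplified] power_mult)
  ultimately obtain h where h: "bij_betw h ?V {0..<2 ^ (p * p) :: nat}"
    using ex_bij_betw_finite_nat[of ?V] by metis
  have h_inj: "x = y" if "h x = h y" "x \<in> ?V" "y \<in> ?V" for x y
    using bij_betw_imp_inj_on[OF h] that by (auto dest!: inj_onD)
  show ?thesis
  proof (intro exI conjI)
    show "rigid {..<?r} (\<lambda>i. h (X (e i))) (\<lambda>i. h (Y (e i))) (\<lambda>i. h (Z (e i)))"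
      unfolding rigid_def
    proof (intro ballI impI)
      fix a b c assume "a \<in> {..<?r}" "b \<in> {..<?r}" "c \<in> {..<?r}"
        and eq: "h (X (e a)) = h (X (e c))" "h (Y (e a)) = h (Y (e b))" "h (Z (e b)) = h (Z (e c))"
      then have abc: "a < ?r" "b < ?r" "c < ?r" by auto
      note eI = e_I[OF abc(1)] e_I[OF abc(2)] e_I[OF abc(3)]
      have "X (e a) = X (e c)" "Y (e a) = Y (e b)" "Z (e b) = Z (e c)"
        using eq eI im h_inj by (auto simp: image_subset_iff)
      then have "e a = e b \<and> e b = e c"
        using I(2) eI unfolding rigid_def by blast
      then show "a = b \<and> b = c"
        using e_inj abc by blast
    qed
    have "h x < 2 ^ (p * p)" if "x \<in> ?V" for x
      using bij_betwE[OF h] that by auto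
    then show "(\<lambda>i. h (X (e i))) ` {..<?r} \<subseteq> {..<2 ^ (p * p)}"
      "(\<lambda>i. h (Y (e i))) ` {..<?r} \<subseteq> {..<2 ^ (p * p)}"
      "(\<lambda>i. h (Z (e i))) ` {..<?r} \<subseteq> {..<2 ^ (p * p)}"
      using e_I im by (auto simp: image_subset_iff)
  qed
qed

section \<open>The barrier\<close>

lemma contains_unit_matmul_target:
  "contains_unit_matmul (kron (kron_pow (unit_tensor 2) \<alpha>) (kron_pow (matmul_tensor 2 2 2) \<beta>))
     (2 ^ \<alpha>) (2 ^ \<beta>)"
  using contains_unit_matmul_kron[OF
      contains_unit_matmul_kron_pow[OF contains_unit_matmul_unit[of 2], of \<alpha>]
      contains_unit_matmul_kron_pow[OF contains_unit_matmul_matmul[of 2], of \<beta>]]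
  by simp

lemma contains_unit_matmul_nonzero:
  fixes t :: "'a::semiring_1 tensor3"
  assumes "contains_unit_matmul t a n" "0 < a" "0 < n" "(0::'a) \<noteq> 1"
  shows "nonzero t"
  using assms(1) unfolding contains_unit_matmul_def
proof (rule containsE, goal_cases)
  case (1 p q r)
  let ?o = "(0, 0, 0) :: nat \<times> nat \<times> nat"
  have "coord t (p ?o) (q ?o) (r ?o) = 1"
    using 1(7)[of ?o ?o ?o] assms(2,3) by simp
  moreover have "p ?o < dim1 t" "q ?o < dim2 t" "r ?o < dim3 t"
    using 1(4-6) assms(2,3) by (auto simp: image_subset_iff)
  ultimately show ?case
    unfolding nonzero_def using assms(4) by metis
qed

lemma omega_M_nonneg: "nonzero s \<Longrightarrow> 0 \<le> omega_M t s"
  unfolding omega_M_eq_INF by (auto intro!: INF_greatest)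

text \<open>Each feasible pair for the target yields feasible pairs for \<langle>2\<rangle> at a
  rate tending to \<alpha> + 2\<beta>. If the target has no feasible pair, its exponent is
  \<infinity> and nothing is to be shown.\<close>

lemma omega_M_target_ge:
  fixes t :: "'a::field tensor3"
  assumes \<beta>: "\<beta> \<ge> 1"
  shows "ereal (real \<alpha> + 2 * real \<beta>) * omega_M t (unit_tensor 2)
    \<le> omega_M t (kron (kron_pow (unit_tensor 2) \<alpha>) (kron_pow (matmul_tensor 2 2 2) \<beta>))"
    (is "_ \<le> omega_M t ?q")
proof -
  note q = contains_unit_matmul_target[of \<alpha> \<beta>, where 'a = 'a]
  have nz: "nonzero ?q"
    by (rule contains_unit_matmul_nonzero[OF q]) auto
  show ?thesis
    unfolding omega_M_eq_INF[OF nz]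
  proof (rule INF_greatest, clarify)
    fix m n assume "(m, n) \<in> feasible monomially_restricts t ?q"
    then have n: "1 \<le> n" and mn: "restr_by monomial (kron_pow t m) (kron_pow ?q n)"
      by (simp_all add: feasible_def monomially_restricts_iff)
    let ?b = "omega_M t (unit_tensor 2)"
    \<comment> \<open>The exponent of 2 gained from \<beta>v^2 copies of \<open>?q\<close>. They
      contain (\<beta>v)^2 factors \<langle>2,2,2\<rangle>, a perfect square as the rigid families
      require.\<close>
    define k where "k v = \<alpha> * (\<beta> * v * v) + (2 * (\<beta> * v) * (\<beta> * v) - 7 * (\<beta> * v))" for v
    \<comment> \<open>Taking \<open>v = n * u\<close> makes the number of copies divisible by
      \<open>n\<close>, so that it is reached by a power of the given relation; \<open>u\<close> is
      free to grow.\<close>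
    have bound: "?b \<le> ereal (real (\<beta> * n * u * u * m) / real (k (n * u)))"
      if u: "u \<ge> 1" "k (n * u) \<ge> 1" for u
    proof -
      let ?v = "n * u"
      let ?N = "\<beta> * ?v * ?v"
      let ?p = "\<beta> * ?v"
      have "?p \<ge> 1" using \<beta> n u by simp
      then obtain X Y Z where XYZ: "rigid {..<2 ^ (2 * ?p * ?p - 7 * ?p) :: nat} X Y Z"
        "X ` {..<2 ^ (2 * ?p * ?p - 7 * ?p) :: nat} \<subseteq> {..<2 ^ (?p * ?p) :: nat}"
        "Y ` {..<2 ^ (2 * ?p * ?p - 7 * ?p) :: nat} \<subseteq> {..<2 ^ (?p * ?p) :: nat}"
        "Z ` {..<2 ^ (2 * ?p * ?p - 7 * ?p) :: nat} \<subseteq> {..<2 ^ (?p * ?p) :: nat}"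
        using exists_rigid_family_nat by blast
      have "contains_unit_matmul (kron_pow ?q ?N) (2 ^ (\<alpha> * ?N)) (2 ^ (?p * ?p))"
        using contains_unit_matmul_kron_pow[OF q, of ?N]
        by (simp add: mult_ac flip: power_mult)
      from rigid_monomially_restricts[OF this XYZ]
      have "restr_by monomial (kron_pow ?q ?N) (kron_pow (unit_tensor 2) (k ?v))"
        by (simp add: monomially_restricts_iff k_def kron_pow_unit power_add)
      moreover have "restr_by monomial (kron_pow t (\<beta> * n * u * u * m)) (kron_pow ?q ?N)"
        using monom.restr_by_kron_pow_mult[OF mn, of "\<beta> * n * u * u"] by (simp add: mult_ac)
      ultimately have "(\<beta> * n * u * u * m, k ?v) \<in> feasible monomially_restricts t (unit_tensor 2)"
        using u(2) monom.restr_by_trans by (auto simp: feasible_def monomially_restricts_iff)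
      then show ?thesis
        unfolding omega_M_eq_INF[OF nonzero_unit] by (rule INF_lower2) simp
    qed
    have k: "real (k v) \<ge> real \<alpha> * real \<beta> * (real v)\<^sup>2 + 2 * (real \<beta>)\<^sup>2 * (real v)\<^sup>2 - 7 * real \<beta> * real v"
      for v
    proof -
      have "real x - real y \<le> real (x - y)" for x y by simp
      from this[of "2 * (\<beta> * v) * (\<beta> * v)" "7 * (\<beta> * v)"]
      show ?thesis by (simp add: k_def power2_eq_square algebra_simps)
    qed
    \<comment> \<open>From \<open>u = 4\<close> on, the quadratic term exceeds the loss, so
      \<open>k\<close> is positive and the subtraction in it is not truncated.\<close>
    have k1: "k (n * u) \<ge> 1" if "u \<ge> 4" for u
    proof -
      have "4 \<le> \<beta> * (n * u)"
        using mult_le_mono[OF \<beta> mult_le_mono[OF n that]] by simp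
      then have "8 * (\<beta> * (n * u)) \<le> 2 * (\<beta> * (n * u)) * (\<beta> * (n * u))" by simp
      then show ?thesis unfolding k_def using \<open>4 \<le> \<beta> * (n * u)\<close> by linarith
    qed
    \<comment> \<open>One feasible pair for the target already makes the exponent for
      \<langle>2\<rangle> finite, so the estimate can continue in the reals.\<close>
    obtain b where b: "?b = ereal b" "b \<ge> 0"
      using bound[of 4] k1[of 4] omega_M_nonneg[OF nonzero_unit, of t] by (cases ?b) auto
    have main: "b * (real \<alpha> + 2 * real \<beta> - 7 / real n * (1 / real u)) \<le> real m / real n"
      if u: "u \<ge> 4" for u
    proof -
      have pos: "real n > 0" "real u > 0" "real \<beta> > 0" using n u \<beta> by simp_all
      have kpos: "real (k (n * u)) > 0" using k1[OF u] by simp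
      have "b \<le> real (\<beta> * n * u * u * m) / real (k (n * u))"
        using bound[of u] k1[OF u] u b by simp
      then have "b * real (k (n * u)) \<le> real (\<beta> * n * u * u * m)"
        using kpos by (simp add: pos_le_divide_eq)
      moreover have "b * (real \<alpha> * real \<beta> * (real (n * u))\<^sup>2 + 2 * (real \<beta>)\<^sup>2 * (real (n * u))\<^sup>2
          - 7 * real \<beta> * real (n * u)) \<le> b * real (k (n * u))"
        by (intro mult_left_mono k b(2))
      ultimately have "b * (real \<alpha> * real \<beta> * (real (n * u))\<^sup>2 + 2 * (real \<beta>)\<^sup>2 * (real (n * u))\<^sup>2
          - 7 * real \<beta> * real (n * u)) \<le> real (\<beta> * n * u * u * m)"
        by linarith
      also have "b * (real \<alpha> * real \<beta> * (real (n * u))\<^sup>2 + 2 * (real \<beta>)\<^sup>2 * (real (n * u))\<^sup>2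
          - 7 * real \<beta> * real (n * u))
        = (real \<beta> * (real n)\<^sup>2 * (real u)\<^sup>2)
          * (b * (real \<alpha> + 2 * real \<beta> - 7 / real n * (1 / real u)))"
        using pos by (simp add: field_simps power2_eq_square)
      also have "real (\<beta> * n * u * u * m) = (real \<beta> * (real n)\<^sup>2 * (real u)\<^sup>2) * (real m / real n)"
        using pos by (simp add: field_simps power2_eq_square)
      finally show ?thesis
        using pos by (subst (asm) mult_le_cancel_left_pos) auto
    qed
    \<comment> \<open>The linear loss shrinks to \<open>7 / (n * u)\<close> after division by
      \<beta>n^2u^2 and disappears as \<open>u\<close> grows.\<close>
    have "(\<lambda>u. b * (real \<alpha> + 2 * real \<beta> - 7 / real n * (1 / real u)))
        \<longlonglongrightarrow> b * (real \<alpha> + 2 * real \<beta> - 7 / real n * 0)"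
      by (intro tendsto_intros lim_const_over_n)
    then have "b * (real \<alpha> + 2 * real \<beta>) \<le> real m / real n"
      using main by (intro LIMSEQ_le_const2[of _ "b * (real \<alpha> + 2 * real \<beta>)"]) auto
    then show "ereal (real \<alpha> + 2 * real \<beta>) * ?b \<le> ereal (real m / real n)"
      by (simp add: b(1) mult.commute)
  qed
qed

theorem theorem3p5:
  fixes t :: "'a::field tensor3" and \<alpha> \<beta> :: nat
  assumes "\<not> is_simple t" and "\<beta> \<ge> 1"
  shows
    "(omega (unit_tensor 2) t
        * omega_M t (kron (kron_pow (unit_tensor 2) \<alpha>) (kron_pow (matmul_tensor 2 2 2) \<beta>))
        - ereal (real \<alpha>)) / ereal (real \<beta>)
      \<ge> 2 * irr_M t + ereal (real \<alpha> / real \<beta>) * (irr_M t - 1)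
     \<and> 2 * irr_M t + ereal (real \<alpha> / real \<beta>) * (irr_M t - 1) \<ge> 2 * irr_M t"
proof -
  let ?c = "omega_M t (kron (kron_pow (unit_tensor 2) \<alpha>) (kron_pow (matmul_tensor 2 2 2) \<beta>))"
  let ?b = "omega_M t (unit_tensor 2)"
  obtain a where a: "omega (unit_tensor 2) t = ereal a" "a \<ge> 1"
    using omega_unit_bounds[OF assms(1)] by (cases "omega (unit_tensor 2) t") auto
  have irr: "irr_M t = ereal a * ?b" "1 \<le> irr_M t"
    using irr_M_ge_1[OF assms(1)] by (simp_all add: irr_M_def a(1))
  have bc: "ereal (real \<alpha> + 2 * real \<beta>) * ?b \<le> ?c"
    by (rule omega_M_target_ge[OF assms(2)])
  have b0: "0 \<le> ?b" by (rule omega_M_nonneg[OF nonzero_unit])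
  have \<beta>: "real \<beta> > 0" using assms(2) by simp
  \<comment> \<open>Valid for infinite \<open>irr_M t\<close> as well; for \<alpha> = 0 the added
    term is then 0 times \<infinity>, which is 0.\<close>
  have second: "2 * irr_M t \<le> 2 * irr_M t + ereal (real \<alpha> / real \<beta>) * (irr_M t - 1)"
  proof -
    have "0 \<le> ereal (real \<alpha> / real \<beta>) * (irr_M t - 1)"
      using irr(2) by (intro ereal_0_le_mult) (auto simp: ereal_diff_positive)
    then show ?thesis by (metis add.right_neutral add_left_mono)
  qed
  have first: "2 * irr_M t + ereal (real \<alpha> / real \<beta>) * (irr_M t - 1)
    \<le> (ereal a * ?c - ereal (real \<alpha>)) / ereal (real \<beta>)"
  proof (cases "?c")
    case PInf
    then show ?thesis using a \<beta> by simp
  next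
    case MInf
    then have "ereal (real \<alpha> + 2 * real \<beta>) * ?b = - \<infinity>" using bc by simp
    then show ?thesis using b0 \<beta> by (cases ?b) auto
  next
    case (real c)
    then obtain b where b: "?b = ereal b"
      using bc b0 \<beta> by (cases ?b) auto
    have "(real \<alpha> + 2 * real \<beta>) * b \<le> c" using bc by (simp add: b real)
    then have "a * ((real \<alpha> + 2 * real \<beta>) * b) \<le> a * c"
      using a(2) by (intro mult_left_mono) auto
    then have "(a * ((real \<alpha> + 2 * real \<beta>) * b) - real \<alpha>) / real \<beta> \<le> (a * c - real \<alpha>) / real \<beta>"
      using \<beta> by (intro divide_right_mono) auto
    \<comment> \<open>Distributing a(\<alpha> + 2\<beta>)b - \<alpha> = 2\<beta>ab + \<alpha>(ab -
      1) produces the middle expression of the claim.\<close>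
    also have "(a * ((real \<alpha> + 2 * real \<beta>) * b) - real \<alpha>) / real \<beta>
        = 2 * (a * b) + real \<alpha> / real \<beta> * (a * b - 1)"
      using \<beta> by (simp add: field_simps)
    finally have "2 * (a * b) + real \<alpha> / real \<beta> * (a * b - 1) \<le> (a * c - real \<alpha>) / real \<beta>" .
    moreover have "2 * ereal (a * b) = ereal (2 * (a * b))" by (metis times_ereal.simps(1) numeral_eq_ereal)
    ultimately show ?thesis
      using \<beta> by (simp add: irr(1) b real one_ereal_def)
  qed
  show ?thesis
    using first second by (simp add: a(1))
qed

end
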